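(* For $\tau>0$ let $\Gamma(\tau)$ be the space group $\mathbf{2q.~I.~2}$ with $q=2$ and translation lattice generated by $2\tau$, i.e. the group of isometries of $\mathbf{S}^2\times\mathbf{R}$ generated by $(P,t)\mapsto(\mathbf{g}_1P,t+\tau)$, $(P,t)\mapsto(\mathbf{g}_2P,t+\tau)$ and $(P,t)\mapsto(P,t+2\tau)$, where $\mathbf{g}_1,\mathbf{g}_2$ are the reflections of $\mathbf{S}^2\subset\mathbb{R}^3$ in the planes $y=0$ and $x=0$ respectively. Let $\mathcal{B}_{opt}(R,K)$ be the ball packing of radius $R=\frac{\pi}{2}$ under $\Gamma(\tau)$ with kernel point $K$ having geographical coordinates $\phi=\frac{\pi}{4}$, $\theta=0$ and fibre coordinate $t=0$, where $\tau$ is determined by $$d(K,K^{\tau\mathbf{g}_1})=d(K,K^{\tau\mathbf{g}_2})=2R,\qquad d(K^{\tau\mathbf{g}_1},K^{\tau\mathbf{g}_2})=2R .$$ Then $\mathcal{B}_{opt}(R,K)$ is the densest simply transitive ball packing belonging to the space group $\mathbf{2q.~I.~2}$ (with $q=2$): for every $\tau'>0$ and every point $K'\in\mathbf{S}^2\times\mathbf{R}$ with trivial stabilizer in $\Gamma(\tau')$, the density $\delta(K')$ of the ball packing of $\Gamma(\tau')$ with kernel point $K'$ is at most the density of $\mathcal{B}_{opt}(R,K)$.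
   Context: $\mathbf{S}^2\times\mathbf{R}$ is the Riemannian product of the unit sphere and the real line, with $ds^2=dt^2+\cos^2\theta\,d\phi^2+d\theta^2$ in geographical coordinates, where the point of $\mathbf{S}^2$ with coordinates $(\phi,\theta)$ is $(x,y,z)=(\cos\phi\cos\theta,\sin\phi\cos\theta,\sin\theta)$ and $t$ is the fibre coordinate; $d$ is the geodesic distance (length of a shortest geodesic) and $\mathrm{Vol}$ the Riemannian volume. The geodesic ball of centre $K$ and radius $\rho\in[0,\pi]$ is $\{Q: d(K,Q)\le\rho\}$. An image of a point $K$ under an isometry $\mathbf{g}$ is written $K^{\mathbf{g}}$; for $K=(P,t)$, $K^{\tau\mathbf{g}_i}=(\mathbf{g}_iP,t+\tau)$. Let $\Gamma$ be a discrete group of isometries of $\mathbf{S}^2\times\mathbf{R}$ as in the claim. The Dirichlet--Voronoi cell of $K$ is $\mathcal{D}(K)=\{X: d(K,X)\le d(K^{\mathbf{g}},X)\ \text{for all } \mathbf{g}\in\Gamma\}$. If the stabilizer of $K$ in $\Gamma$ is trivial (so $\Gamma$ acts simply transitively on the orbit $K^\Gamma$), let $\mathcal{B}_K$ be the greatest geodesic ball with centre $K$ inside $\mathcal{D}(K)$; its radius is $\rho(K)=\min_{\mathbf{g}\in\Gamma\setminus\{1\}}\frac12 d(K,K^{\mathbf{g}})$. The $\Gamma$-images of $\mathcal{B}_K$ form the (simply transitive) ball packing of $\Gamma$ with kernel point $K$, whose density is $\delta(K)=\mathrm{Vol}(\mathcal{B}_K)/\mathrm{Vol}(\mathcal{D}(K))$.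 For identification of the arrangement $\mathcal{B}_{opt}(R,K)$: numerically $\mathrm{Vol}(\mathcal{B}_K)\approx13.74539472$ and its density is $\approx0.80407553$. *)

theory Defs
  imports
    "HOL-Analysis.Analysis"
    "HOL-Algebra.Bij"
    "HOL-Algebra.Generated_Groups"
    "HOL-Algebra.Group_Action"
begin

type_synonym pt = "(real^3) \<times> real"

definition S2R :: "pt set" where
  "S2R = sphere 0 1 \<times> UNIV"

definition geo :: "real \<Rightarrow> real \<Rightarrow> real^3" where
  "geo \<phi> \<theta> = vector [cos \<phi> * cos \<theta>, sin \<phi> * cos \<theta>, sin \<theta>]"


text \<open>The product metric \<open>dt^2 + cos^2 \<theta> d\<phi>^2 + d\<theta>^2\<close> is the one induced by the
  inner product of the ambient space \<open>\<real>^3 \<times> \<real>\<close>. Its geodesics, parametrized affinely on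
  \<open>[0,1]\<close>, are thus the curves on the submanifold whose tangential acceleration vanishes.\<close>

definition tangent_space :: "pt \<Rightarrow> pt set" where
  "tangent_space X = {V. fst X \<bullet> fst V = 0}"

definition geodesic :: "(real \<Rightarrow> pt) \<Rightarrow> bool" where
  "geodesic c \<longleftrightarrow> (\<exists>c' c''. \<forall>s\<in>{0..1}.
     c s \<in> S2R \<and>
     (c has_vector_derivative c' s) (at s within {0..1}) \<and>
     (c' has_vector_derivative c'' s) (at s within {0..1}) \<and>
     (\<forall>V\<in>tangent_space (c s). c'' s \<bullet> V = 0))"

definition curve_length :: "(real \<Rightarrow> pt) \<Rightarrow> real" where
  "curve_length c = integral {0..1} (\<lambda>s. norm (vector_derivative c (at s within {0..1})))"

definition gdist :: "pt \<Rightarrow> pt \<Rightarrow> real" where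
  "gdist X Y = Inf {curve_length c | c. geodesic c \<and> c 0 = X \<and> c 1 = Y}"

definition gball :: "pt \<Rightarrow> real \<Rightarrow> pt set" where
  "gball K \<rho> = {Q \<in> S2R. gdist K Q \<le> \<rho>}"


text \<open>The volume element \<open>cos \<theta> d\<phi> d\<theta> dt\<close> in geographical coordinates, pushed forward to a
  Borel measure on the ambient space that is concentrated on \<^const>\<open>S2R\<close>. The chart covers
  \<^const>\<open>S2R\<close> and is injective off the poles.\<close>

definition riem_vol :: "pt measure" where
  "riem_vol = distr
     (density lborel (\<lambda>(\<phi>, \<theta>, t). ennreal (cos \<theta>) *
        indicator ({-pi<..pi} \<times> {-pi/2..pi/2} \<times> UNIV) (\<phi>, \<theta>, t)))
     borel (\<lambda>(\<phi>, \<theta>, t :: real). (geo \<phi> \<theta>, t))"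


definition isom_group :: "(pt \<Rightarrow> pt) monoid" where
  "isom_group = (BijGroup S2R)\<lparr>carrier :=
     {f \<in> Bij S2R. \<forall>X\<in>S2R. \<forall>Y\<in>S2R. gdist (f X) (f Y) = gdist X Y}\<rparr>"

definition refl1 :: "real^3 \<Rightarrow> real^3" where
  "refl1 P = vector [P $ 1, - P $ 2, P $ 3]"

definition refl2 :: "real^3 \<Rightarrow> real^3" where
  "refl2 P = vector [- P $ 1, P $ 2, P $ 3]"

text \<open>Elements of \<^const>\<open>BijGroup\<close> are extensional functions, hence the bounded abstraction.\<close>

definition lift_isom :: "(real^3 \<Rightarrow> real^3) \<Rightarrow> real \<Rightarrow> pt \<Rightarrow> pt" where
  "lift_isom g \<tau> = (\<lambda>X\<in>S2R. (g (fst X), snd X + \<tau>))"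

definition space_group :: "real \<Rightarrow> (pt \<Rightarrow> pt) monoid" where
  "space_group \<tau> = subgroup_generated isom_group
     {lift_isom refl1 \<tau>, lift_isom refl2 \<tau>, lift_isom id (2 * \<tau>)}"


definition trivial_stabilizer :: "(pt \<Rightarrow> pt) monoid \<Rightarrow> pt \<Rightarrow> bool" where
  "trivial_stabilizer G K \<longleftrightarrow> stabilizer G (\<lambda>g. g) K = {\<one>\<^bsub>G\<^esub>}"

definition dv_cell :: "(pt \<Rightarrow> pt) monoid \<Rightarrow> pt \<Rightarrow> pt set" where
  "dv_cell G K = {X \<in> S2R. \<forall>g\<in>carrier G. gdist K X \<le> gdist (g K) X}"

definition packing_radius :: "(pt \<Rightarrow> pt) monoid \<Rightarrow> pt \<Rightarrow> real" where
  "packing_radius G K = (GREATEST \<rho>. \<rho> \<in> {0..pi} \<and> gball K \<rho> \<subseteq> dv_cell G K)"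

definition packing_ball :: "(pt \<Rightarrow> pt) monoid \<Rightarrow> pt \<Rightarrow> pt set" where
  "packing_ball G K = gball K (packing_radius G K)"

definition packing_density :: "(pt \<Rightarrow> pt) monoid \<Rightarrow> pt \<Rightarrow> real" where
  "packing_density G K =
     measure riem_vol (packing_ball G K) / measure riem_vol (dv_cell G K)"

end

theory Submission
  imports Defs
begin

text \<open>
  The geodesic distance of the product is the Pythagorean combination of the angle on the sphere
  and the difference of the fibre coordinates (\<open>gdist_eq\<close>). The group \<open>\<Gamma>(\<tau>)\<close> consists of the motions
  \<open>(P, s) \<mapsto> (g P, s + k \<tau>)\<close>, where \<open>g\<close> is the identity or the half turn about the \<open>z\<close>-axis for even
  \<open>k\<close>, and one of the two reflections for odd \<open>k\<close> (\<open>carrier_space_group\<close>). The half slab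
  \<open>y > 0\<close>, \<open>0 \<le> s < \<tau>\<close> is therefore a fundamental domain up to a null set, of volume
  \<open>2 \<pi> \<tau>\<close>. The Dirichlet--Voronoi cell of a point with trivial stabilizer is another one, and has
  the same volume (\<open>emeasure_dv_cell\<close>). Hence the density of a packing of radius \<open>r\<close> is
  \<open>V(r) / (2 \<pi> \<tau>)\<close>, where \<open>V(r)\<close> is the volume of a ball of radius \<open>r\<close>, which does not depend
  on its centre (\<open>emeasure_gball\<close>).

  Put \<open>R = \<pi>/2\<close>. Three kinds of motions bound the packing radius (\<open>packing_radius_bounds\<close>): the half
  turn gives \<open>r \<le> R\<close>, the translation by \<open>2 \<tau>\<close> gives \<open>r \<le> \<tau>\<close>, and, since one of the two
  reflections moves the kernel point by an angle of at most \<open>\<pi>/2\<close>, also \<open>4 r\<^sup>2 \<le> R\<^sup>2 + \<tau>\<^sup>2\<close>. Together they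
  imply \<open>\<surd>3 r\<^sup>2 \<le> R \<tau>\<close> (\<open>radius_period_inequality\<close>), with equality for \<open>r = R\<close> and \<open>\<tau> = \<surd>3 R\<close>.

  On the other hand \<open>V(r) \<le> (r/R)\<^sup>2 V(R)\<close> for \<open>r \<le> R\<close> (\<open>ball_vol_scale\<close>): shrinking the ball by a
  factor \<open>l\<close> scales its extent in the fibre by \<open>l\<close>, and the area \<open>2 \<pi> (1 - cos x)\<close> of each of its
  spherical sections by at most \<open>l\<close>, because \<open>1 - cos\<close> is convex on \<open>[0, \<pi>/2]\<close> and vanishes at \<open>0\<close>.
  Consequently \<open>V(r) / (2 \<pi> \<tau>) \<le> V(R) / (2 \<pi> \<surd>3 R)\<close>, which is the density of the packing with
  kernel point \<open>K\<close> and \<open>\<tau> = \<surd>3 R\<close>.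

  The analytic core is that the area of a spherical cap depends on its radius only
  (\<open>emeasure_cap_independent\<close>). The volume is given by a formula in geographical coordinates, which
  does not show this invariance.
\<close>

section \<open>Geodesic distance\<close>

definition sdist :: "real^3 \<Rightarrow> real^3 \<Rightarrow> real" where
  "sdist P Q = arccos (P \<bullet> Q)"

lemma inner_sphere_bounds:
  fixes P Q :: "real^3"
  assumes "norm P = 1" "norm Q = 1"
  shows "-1 \<le> P \<bullet> Q" "P \<bullet> Q \<le> 1"
  using Cauchy_Schwarz_ineq2[of P Q] assms by (auto simp: abs_le_iff)

lemma sdist_bounds:
  assumes "norm P = 1" "norm Q = 1"
  shows "0 \<le> sdist P Q" "sdist P Q \<le> pi" "cos (sdist P Q) = P \<bullet> Q"
  using inner_sphere_bounds[OF assms] by (auto simp: sdist_def arccos_lbound arccos_ubound)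

lemma sdist_commute: "sdist P Q = sdist Q P"
  by (simp add: sdist_def inner_commute)

lemma unit_orthogonal_exists:
  fixes P :: "real^3"
  shows "\<exists>W. norm W = 1 \<and> P \<bullet> W = 0"
proof -
  obtain x where x: "x \<noteq> 0" "orthogonal P x"
    using orthogonal_to_vector_exists[of P] by auto
  then have "norm (x /\<^sub>R norm x) = 1 \<and> P \<bullet> (x /\<^sub>R norm x) = 0"
    by (simp add: orthogonal_def)
  then show ?thesis by blast
qed

text \<open>The vector \<open>W\<close> is the initial direction of a shortest great circle arc from \<open>P\<close> to \<open>Q\<close>. If
  \<open>Q = P\<close> or \<open>Q = - P\<close>, every direction orthogonal to \<open>P\<close> will do.\<close>

lemma sphere_polar_form:
  fixes P Q :: "real^3"
  assumes "norm P = 1" "norm Q = 1"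
  obtains W where "norm W = 1" "P \<bullet> W = 0" "Q = cos (sdist P Q) *\<^sub>R P + sin (sdist P Q) *\<^sub>R W"
proof -
  define a where "a = sdist P Q"
  have ca: "cos a = P \<bullet> Q" and a: "0 \<le> a" "a \<le> pi"
    using sdist_bounds[OF assms] by (auto simp: a_def)
  have PP: "P \<bullet> P = 1" "Q \<bullet> Q = 1" using assms by (auto simp: norm_eq_1)
  define U where "U = Q - cos a *\<^sub>R P"
  have PU: "P \<bullet> U = 0" by (simp add: U_def inner_diff_right PP ca)
  have UU: "U \<bullet> U = (sin a)\<^sup>2"
    using PP by (simp add: U_def inner_diff_left inner_diff_right ca[symmetric] inner_commute
        sin_squared_eq power2_eq_square algebra_simps)
  show ?thesis
  proof (cases "sin a = 0")
    case True
    then have "U = 0" using UU by simp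
    obtain W where "norm W = 1" "P \<bullet> W = 0" using unit_orthogonal_exists by blast
    then show ?thesis using that[of W] True \<open>U = 0\<close> by (simp add: a_def[symmetric] U_def)
  next
    case False
    have "norm U = \<bar>sin a\<bar>" by (simp add: norm_eq_sqrt_inner UU)
    then have "norm (U /\<^sub>R sin a) = 1" "P \<bullet> (U /\<^sub>R sin a) = 0"
      using False PU by auto
    moreover have "Q = cos a *\<^sub>R P + sin a *\<^sub>R (U /\<^sub>R sin a)"
      using False by (simp add: U_def)
    ultimately show ?thesis using that[folded a_def] by blast
  qed
qed

text \<open>In polar form around \<open>Q\<close> the inner product \<open>P \<bullet> S\<close> equals
  \<open>cos a * cos b + sin a * sin b * (V \<bullet> W)\<close>, which is at least \<open>cos (a + b)\<close>; and \<open>arccos\<close> is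
  decreasing.\<close>

lemma sdist_triangle:
  assumes "norm P = 1" "norm Q = 1" "norm S = 1"
  shows "sdist P S \<le> sdist P Q + sdist Q S"
proof (cases "sdist P Q + sdist Q S \<le> pi")
  case False
  then show ?thesis using sdist_bounds(2)[OF assms(1,3)] by simp
next
  case True
  define a where "a = sdist Q P"
  define b where "b = sdist Q S"
  have ab: "0 \<le> a" "a \<le> pi" "0 \<le> b" "b \<le> pi" "a + b \<le> pi"
    using sdist_bounds assms True by (auto simp: a_def b_def sdist_commute)
  obtain V where V: "norm V = 1" "Q \<bullet> V = 0" "P = cos a *\<^sub>R Q + sin a *\<^sub>R V"
    using sphere_polar_form[OF assms(2,1)] unfolding a_def by blast
  obtain W where W: "norm W = 1" "Q \<bullet> W = 0" "S = cos b *\<^sub>R Q + sin b *\<^sub>R W"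
    using sphere_polar_form[OF assms(2,3)] unfolding b_def by blast
  have "P \<bullet> S = cos a * cos b + sin a * sin b * (V \<bullet> W)"
    using V(2) W(2) assms(2)
    by (simp add: V(3) W(3) inner_add_left inner_add_right inner_commute norm_eq_1 algebra_simps)
  moreover have "sin a * sin b * (-1) \<le> sin a * sin b * (V \<bullet> W)"
    using ab inner_sphere_bounds(1)[OF V(1) W(1)] by (intro mult_left_mono mult_nonneg_nonneg sin_ge_zero) auto
  ultimately have "cos (a + b) \<le> P \<bullet> S" by (simp add: cos_add)
  then have "arccos (P \<bullet> S) \<le> arccos (cos (a + b))"
    using inner_sphere_bounds[OF assms(1,3)] by (intro arccos_le_arccos) auto
  then show ?thesis using ab by (simp add: arccos_cos sdist_def[symmetric] a_def b_def sdist_commute)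
qed

lemma S2R_iff: "X \<in> S2R \<longleftrightarrow> norm (fst X) = 1"
  by (cases X) (auto simp: S2R_def)

text \<open>A closed form for \<^const>\<open>gdist\<close>; the agreement on \<^const>\<open>S2R\<close> is \<open>gdist_eq\<close> below.\<close>

definition pdist :: "pt \<Rightarrow> pt \<Rightarrow> real" where
  "pdist X Y = sqrt ((sdist (fst X) (fst Y))\<^sup>2 + (snd Y - snd X)\<^sup>2)"

lemma harmonic_unique:
  fixes f f' :: "real \<Rightarrow> real" and v :: real
  assumes f: "\<And>s. s \<in> {0..1} \<Longrightarrow> (f has_vector_derivative f' s) (at s within {0..1})"
    and f': "\<And>s. s \<in> {0..1} \<Longrightarrow> (f' has_vector_derivative - (v\<^sup>2 * f s)) (at s within {0..1})"
    and 0: "f 0 = 1" "f' 0 = 0" and s: "s \<in> {0..1}"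
  shows "f s = cos (v * s)"
proof -
  define g where "g = (\<lambda>s. f s - cos (v * s))"
  define g' where "g' = (\<lambda>s. f' s + v * sin (v * s))"
  have g: "(g has_field_derivative g' s) (at s within {0..1})" if "s \<in> {0..1}" for s
    using f[OF that] unfolding g_def g'_def has_real_derivative_iff_has_vector_derivative[symmetric]
    by (auto intro!: derivative_eq_intros)
  have g': "(g' has_field_derivative - (v\<^sup>2 * g s)) (at s within {0..1})" if "s \<in> {0..1}" for s
    using f'[OF that] unfolding g_def g'_def has_real_derivative_iff_has_vector_derivative[symmetric]
    by (auto intro!: derivative_eq_intros simp: power2_eq_square algebra_simps)
  \<comment> \<open>the energy of the difference of the two solutions is conserved\<close>
  have "((\<lambda>s. v\<^sup>2 * (g s)\<^sup>2 + (g' s)\<^sup>2) has_field_derivative 0) (at s within {0..1})"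
    if "s \<in> {0..1}" for s
    using g[OF that] g'[OF that]
    by (auto intro!: derivative_eq_intros simp: power2_eq_square algebra_simps)
  then have "\<exists>c. \<forall>s\<in>{0..1}. v\<^sup>2 * (g s)\<^sup>2 + (g' s)\<^sup>2 = c"
    by (intro has_field_derivative_zero_constant) auto
  then obtain c where c: "\<And>s. s \<in> {0..1} \<Longrightarrow> v\<^sup>2 * (g s)\<^sup>2 + (g' s)\<^sup>2 = c" by blast
  have "c = 0" using c[of 0] 0 by (simp add: g_def g'_def)
  then have "g' s = 0" if "s \<in> {0..1}" for s
    using c[OF that] by (simp add: add_nonneg_eq_0_iff)
  then have "\<exists>d. \<forall>s\<in>{0..1}. g s = d"
    using has_field_derivative_zero_constant[of "{0..1::real}" g] g by auto
  then have "g s = g 0" using s by (metis atLeastAtMost_iff order_refl zero_le_one)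
  then show ?thesis using 0 by (simp add: g_def)
qed

lemma inner_has_vector_derivative:
  fixes f g :: "real \<Rightarrow> 'a::real_inner"
  assumes "(f has_vector_derivative f') (at s within A)" "(g has_vector_derivative g') (at s within A)"
  shows "((\<lambda>s. f s \<bullet> g s) has_vector_derivative (f s \<bullet> g' + f' \<bullet> g s)) (at s within A)"
  using has_derivative_inner[OF assms[unfolded has_vector_derivative_def]]
  by (simp add: has_vector_derivative_def distrib_left)

lemma vector_derivative_unit_interval_eq:
  fixes f :: "real \<Rightarrow> 'a::euclidean_space"
  assumes "(f has_vector_derivative a) (at s within {0..1})"
    "(f has_vector_derivative b) (at s within {0..1})" "s \<in> {0..1}"
  shows "a = b"
  using assms vector_derivative_within_closed_interval[of 0 1 s f] by auto

text \<open>Along a geodesic the fibre coordinate is affine and the spherical component \<open>p\<close> solves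
  \<open>p'' = - v\<^sup>2 p\<close> with constant speed \<open>v\<close>. Pairing with \<open>p 0\<close> gives
  \<open>p 0 \<bullet> p s = cos (v s)\<close>, so that \<open>v\<close> is at least the angle between the end points.\<close>

lemma geodesic_length_ge:
  assumes c: "geodesic c"
  shows "pdist (c 0) (c 1) \<le> curve_length c"
proof -
  obtain c' c'' where c: "\<And>s. s \<in> {0..1} \<Longrightarrow> c s \<in> S2R"
    and c': "\<And>s. s \<in> {0..1} \<Longrightarrow> (c has_vector_derivative c' s) (at s within {0..1})"
    and c'': "\<And>s. s \<in> {0..1} \<Longrightarrow> (c' has_vector_derivative c'' s) (at s within {0..1})"
    and tan: "\<And>s V. s \<in> {0..1} \<Longrightarrow> V \<in> tangent_space (c s) \<Longrightarrow> c'' s \<bullet> V = 0"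
    using c unfolding geodesic_def by metis
  define p p' p'' where "p = (\<lambda>s. fst (c s))" and "p' = (\<lambda>s. fst (c' s))" and "p'' = (\<lambda>s. fst (c'' s))"
  define t t' t'' where "t = (\<lambda>s. snd (c s))" and "t' = (\<lambda>s. snd (c' s))" and "t'' = (\<lambda>s. snd (c'' s))"
  have p1: "p s \<bullet> p s = 1" if "s \<in> {0..1}" for s
    using c[OF that] by (simp add: p_def S2R_iff norm_eq_1)
  have dp: "(p has_vector_derivative p' s) (at s within {0..1})"
    and dt: "(t has_vector_derivative t' s) (at s within {0..1})" if "s \<in> {0..1}" for s
    using c'[OF that] unfolding p_def p'_def t_def t'_def has_vector_derivative_def
    by (auto dest: has_derivative_fst has_derivative_snd)
  have dp': "(p' has_vector_derivative p'' s) (at s within {0..1})"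
    and dt': "(t' has_vector_derivative t'' s) (at s within {0..1})" if "s \<in> {0..1}" for s
    using c''[OF that] unfolding p''_def p'_def t''_def t'_def has_vector_derivative_def
    by (auto dest: has_derivative_fst has_derivative_snd)
  have t''0: "t'' s = 0" if "s \<in> {0..1}" for s
    using tan[OF that, of "(0, 1)"] by (simp add: tangent_space_def t''_def inner_prod_def)
  have perp: "p'' s \<bullet> V = 0" if "s \<in> {0..1}" "p s \<bullet> V = 0" for s V
    using tan[OF that(1), of "(V, 0)"] that(2) by (simp add: tangent_space_def p''_def p_def inner_prod_def)
  have pp': "p s \<bullet> p' s = 0" if s: "s \<in> {0..1}" for s
  proof -
    have "((\<lambda>s. p s \<bullet> p s) has_vector_derivative (p s \<bullet> p' s + p' s \<bullet> p s)) (at s within {0..1})"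
      by (intro inner_has_vector_derivative dp s)
    moreover have "((\<lambda>s. p s \<bullet> p s) has_vector_derivative 0) (at s within {0..1})"
      by (rule has_vector_derivative_transform[OF s _ has_vector_derivative_const[of 1]]) (simp add: p1)
    ultimately have "p s \<bullet> p' s + p' s \<bullet> p s = 0"
      by (rule vector_derivative_unit_interval_eq[OF _ _ s])
    then show ?thesis by (simp add: inner_commute)
  qed
  have pp'': "p s \<bullet> p'' s + p' s \<bullet> p' s = 0" if s: "s \<in> {0..1}" for s
  proof -
    have "((\<lambda>s. p s \<bullet> p' s) has_vector_derivative (p s \<bullet> p'' s + p' s \<bullet> p' s)) (at s within {0..1})"
      by (intro inner_has_vector_derivative dp dp' s)
    moreover have "((\<lambda>s. p s \<bullet> p' s) has_vector_derivative 0) (at s within {0..1})"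
      by (rule has_vector_derivative_transform[OF s _ has_vector_derivative_const[of 0]]) (simp add: pp')
    ultimately show ?thesis by (rule vector_derivative_unit_interval_eq[OF _ _ s])
  qed
  define v where "v = norm (p' 0)"
  have vv: "p' s \<bullet> p' s = v\<^sup>2" if s: "s \<in> {0..1}" for s
  proof -
    have "((\<lambda>s. p' s \<bullet> p' s) has_field_derivative 0) (at s within {0..1})" if s: "s \<in> {0..1}" for s
      using inner_has_vector_derivative[OF dp'[OF s] dp'[OF s]] perp[OF s pp'[OF s]]
      by (simp add: has_real_derivative_iff_has_vector_derivative inner_commute)
    then have "\<exists>d. \<forall>s\<in>{0..1}. p' s \<bullet> p' s = d"
      using has_field_derivative_zero_constant[of "{0..1::real}" "\<lambda>s. p' s \<bullet> p' s"] by auto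
    then have "p' s \<bullet> p' s = p' 0 \<bullet> p' 0"
      using s by (metis atLeastAtMost_iff order_refl zero_le_one)
    then show ?thesis by (simp add: v_def power2_norm_eq_inner)
  qed
  have p''_eq: "p'' s = - (v\<^sup>2) *\<^sub>R p s" if s: "s \<in> {0..1}" for s
  proof -
    \<comment> \<open>the residual is tangential, hence orthogonal to \<open>p''\<close>, and orthogonal to \<open>p\<close>\<close>
    define U where "U = p'' s + v\<^sup>2 *\<^sub>R p s"
    have pU: "p s \<bullet> U = 0"
      using pp''[OF s] vv[OF s] p1[OF s] by (simp add: U_def inner_add_right)
    have "U \<bullet> U = p'' s \<bullet> U + v\<^sup>2 * (p s \<bullet> U)" by (simp add: U_def inner_add_left)
    then have "U = 0" using pU perp[OF s pU] by simp
    then show ?thesis by (simp add: U_def eq_neg_iff_add_eq_0)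
  qed
  have f: "p 0 \<bullet> p 1 = cos (v * 1)"
  proof (rule harmonic_unique[where f = "\<lambda>s. p 0 \<bullet> p s" and f' = "\<lambda>s. p 0 \<bullet> p' s"])
    fix s :: real assume s: "s \<in> {0..1}"
    show "((\<lambda>s. p 0 \<bullet> p s) has_vector_derivative p 0 \<bullet> p' s) (at s within {0..1})"
      using inner_has_vector_derivative[OF has_vector_derivative_const dp[OF s], of "p 0"] by simp
    show "((\<lambda>s. p 0 \<bullet> p' s) has_vector_derivative - (v\<^sup>2 * (p 0 \<bullet> p s))) (at s within {0..1})"
      using inner_has_vector_derivative[OF has_vector_derivative_const dp'[OF s], of "p 0"]
      by (simp add: p''_eq[OF s])
  qed (use p1[of 0] pp'[of 0] in auto)
  have le: "sdist (p 0) (p 1) \<le> v"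
  proof (cases "v \<le> pi")
    case True
    then show ?thesis using f by (simp add: sdist_def arccos_cos v_def)
  next
    case False
    have "sdist (p 0) (p 1) \<le> pi" using c[of 0] c[of 1] by (intro sdist_bounds) (auto simp: p_def S2R_iff)
    then show ?thesis using False by simp
  qed
  have t'c: "t' s = t' 0" if "s \<in> {0..1}" for s
  proof -
    have "\<exists>d. \<forall>s\<in>{0..1}. t' s = d"
      using has_field_derivative_zero_constant[of "{0..1::real}" t'] dt' t''0
      by (auto simp: has_real_derivative_iff_has_vector_derivative)
    then show ?thesis using that by (metis atLeastAtMost_iff order_refl zero_le_one)
  qed
  have t1: "t 1 - t 0 = t' 0"
  proof -
    have "((\<lambda>s. t s - s * t' 0) has_field_derivative 0) (at s within {0..1})" if "s \<in> {0..1}" for s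
      using dt[OF that] t'c[OF that]
      by (auto simp: has_real_derivative_iff_has_vector_derivative[symmetric] intro!: derivative_eq_intros)
    then have "\<exists>d. \<forall>s\<in>{0..1}. t s - s * t' 0 = d"
      using has_field_derivative_zero_constant[of "{0..1::real}" "\<lambda>s. t s - s * t' 0"] by auto
    then have "t 1 - 1 * t' 0 = t 0 - 0 * t' 0" by (metis atLeastAtMost_iff order_refl zero_le_one)
    then show ?thesis by simp
  qed
  have nc: "norm (vector_derivative c (at s within {0..1})) = sqrt (v\<^sup>2 + (t' 0)\<^sup>2)" if s: "s \<in> {0..1}" for s
  proof -
    have "vector_derivative c (at s within {0..1}) = c' s"
      using vector_derivative_within_closed_interval[OF _ s c'[OF s]] by simp
    then show ?thesis using vv[OF s] t'c[OF s]
      by (simp add: p'_def t'_def norm_eq_sqrt_inner inner_prod_def power2_eq_square)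
  qed
  have "curve_length c = integral {0..1} (\<lambda>s::real. sqrt (v\<^sup>2 + (t' 0)\<^sup>2))"
    unfolding curve_length_def by (rule integral_cong) (simp add: nc)
  also have "\<dots> = sqrt (v\<^sup>2 + (t' 0)\<^sup>2)" by simp
  finally have L: "curve_length c = sqrt (v\<^sup>2 + (t' 0)\<^sup>2)" .
  have "(sdist (p 0) (p 1))\<^sup>2 \<le> v\<^sup>2"
    using le sdist_bounds(1)[of "p 0" "p 1"] c[of 0] c[of 1]
    by (intro power_mono) (auto simp: p_def S2R_iff)
  then show ?thesis unfolding L pdist_def using t1 by (simp add: p_def t_def)
qed

text \<open>A great circle arc of constant speed, combined with an affine motion in the fibre. The distances
  between its intermediate points are recorded because a point just beyond the midpoint of such a
  segment limits the packing radius in \<open>gball_subset_dv_cell_iff\<close>.\<close>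

lemma minimal_geodesic_exists:
  assumes X: "X \<in> S2R" and Y: "Y \<in> S2R"
  obtains c where "geodesic c" "c 0 = X" "c 1 = Y" "curve_length c = pdist X Y"
    "\<And>u w. u \<in> {0..1} \<Longrightarrow> w \<in> {0..1} \<Longrightarrow> pdist (c u) (c w) = \<bar>u - w\<bar> * pdist X Y"
    "\<And>u. c u \<in> S2R"
proof -
  define P Q where "P = fst X" and "Q = fst Y"
  have PQ: "norm P = 1" "norm Q = 1" using X Y by (auto simp: P_def Q_def S2R_iff)
  define a where "a = sdist P Q"
  define b where "b = snd Y - snd X"
  have a: "0 \<le> a" "a \<le> pi" using sdist_bounds[OF PQ] by (auto simp: a_def)
  obtain W where W: "norm W = 1" "P \<bullet> W = 0" "Q = cos a *\<^sub>R P + sin a *\<^sub>R W"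
    using sphere_polar_form[OF PQ] unfolding a_def by blast
  have PP: "P \<bullet> P = 1" "W \<bullet> W = 1" "W \<bullet> P = 0" using PQ W by (auto simp: norm_eq_1 inner_commute)
  define c where "c = (\<lambda>u. (cos (u * a) *\<^sub>R P + sin (u * a) *\<^sub>R W, snd X + u * b))"
  define c' where "c' = (\<lambda>u. (- (a * sin (u * a)) *\<^sub>R P + (a * cos (u * a)) *\<^sub>R W, b))"
  define c'' where "c'' = (\<lambda>u. (- (a * a * cos (u * a)) *\<^sub>R P - (a * a * sin (u * a)) *\<^sub>R W, 0::real))"
  have inner_c: "fst (c u) \<bullet> fst (c w) = cos ((u - w) * a)" for u w
    using PP W(2) by (simp add: c_def inner_add_left inner_add_right cos_diff left_diff_distrib)
  have cS: "c u \<in> S2R" for u using inner_c[of u u] by (simp add: S2R_iff norm_eq_1)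
  have dc: "(c has_vector_derivative c' u) (at u within A)" for u A
    unfolding c_def c'_def by (auto intro!: derivative_eq_intros simp: algebra_simps)
  have dc': "(c' has_vector_derivative c'' u) (at u within A)" for u A
    unfolding c'_def c''_def by (auto intro!: derivative_eq_intros simp: algebra_simps)
  have ct: "c'' u \<bullet> V = 0" if "V \<in> tangent_space (c u)" for u V
  proof -
    have "c'' u \<bullet> V = - (a * a) * (fst (c u) \<bullet> fst V)"
      by (simp add: c''_def c_def inner_prod_def inner_add_left inner_diff_left algebra_simps)
    then show ?thesis using that by (simp add: tangent_space_def)
  qed
  have geod: "geodesic c" unfolding geodesic_def using cS dc dc' ct by blast
  have d: "pdist (c u) (c w) = \<bar>u - w\<bar> * pdist X Y" if uw: "u \<in> {0..1}" "w \<in> {0..1}" for u w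
  proof -
    have uw1: "\<bar>u - w\<bar> \<le> 1" using uw by auto
    have "arccos (cos ((u - w) * a)) = \<bar>u - w\<bar> * a"
    proof -
      have "\<bar>u - w\<bar> * a \<le> 1 * pi" using a uw1 by (intro mult_mono) auto
      then have "arccos (cos (\<bar>u - w\<bar> * a)) = \<bar>u - w\<bar> * a" using a by (intro arccos_cos) auto
      moreover have "cos (\<bar>u - w\<bar> * a) = cos ((u - w) * a)"
        by (metis abs_if cos_minus mult_minus_left)
      ultimately show ?thesis by simp
    qed
    then have "pdist (c u) (c w) = sqrt ((\<bar>u - w\<bar> * a)\<^sup>2 + (w * b - u * b)\<^sup>2)"
      by (simp add: pdist_def sdist_def inner_c) (simp add: c_def)
    also have "(\<bar>u - w\<bar> * a)\<^sup>2 + (w * b - u * b)\<^sup>2 = \<bar>u - w\<bar>\<^sup>2 * (a\<^sup>2 + b\<^sup>2)"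
      by (simp add: power2_eq_square algebra_simps)
    also have "sqrt \<dots> = \<bar>u - w\<bar> * pdist X Y"
      by (simp add: real_sqrt_mult pdist_def a_def b_def P_def Q_def)
    finally show ?thesis .
  qed
  have nc: "norm (vector_derivative c (at u within {0..1})) = pdist X Y" if u: "u \<in> {0..1}" for u
  proof -
    have "vector_derivative c (at u within {0..1}) = c' u"
      using vector_derivative_within_closed_interval[OF _ u dc] by simp
    moreover have "fst (c' u) \<bullet> fst (c' u) = a\<^sup>2"
    proof -
      have "fst (c' u) \<bullet> fst (c' u) = (a * sin (u * a))\<^sup>2 + (a * cos (u * a))\<^sup>2"
        using PP W(2) by (simp add: c'_def inner_diff_left inner_diff_right power2_eq_square)
      then show ?thesis by (simp add: power_mult_distrib distrib_left[symmetric])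
    qed
    moreover have "snd (c' u) = b" by (simp add: c'_def)
    ultimately show ?thesis
      by (simp add: norm_eq_sqrt_inner inner_prod_def pdist_def a_def b_def P_def Q_def power2_eq_square)
  qed
  have "curve_length c = integral {0..1} (\<lambda>u::real. pdist X Y)"
    unfolding curve_length_def by (rule integral_cong) (simp add: nc)
  then have "curve_length c = pdist X Y" by simp
  moreover have "c 0 = X" "c 1 = Y" using W(3) by (auto simp: c_def b_def P_def Q_def intro!: prod_eqI)
  ultimately show ?thesis using that geod d cS by blast
qed

lemma gdist_eq:
  assumes "X \<in> S2R" "Y \<in> S2R"
  shows "gdist X Y = pdist X Y"
proof -
  obtain c where "geodesic c" "c 0 = X" "c 1 = Y" "curve_length c = pdist X Y"
    using minimal_geodesic_exists[OF assms] by metis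
  then show ?thesis unfolding gdist_def
    by (intro cInf_eq_minimum) (auto intro!: exI[of _ c] dest: geodesic_length_ge)
qed

lemma pdist_nonneg [simp]: "0 \<le> pdist X Y" by (simp add: pdist_def)

lemma pdist_commute: "pdist X Y = pdist Y X"
  by (simp add: pdist_def sdist_commute power2_commute)

lemma pdist_triangle:
  assumes "X \<in> S2R" "Y \<in> S2R" "Z \<in> S2R"
  shows "pdist X Z \<le> pdist X Y + pdist Y Z"
proof -
  let ?n = "\<lambda>X Y. (sdist (fst X) (fst Y), snd Y - snd X)"
  have n: "norm (?n X Y) = pdist X Y" for X Y by (simp add: norm_Pair pdist_def)
  have "sdist (fst X) (fst Z) \<le> sdist (fst X) (fst Y) + sdist (fst Y) (fst Z)"
    using assms by (intro sdist_triangle) (auto simp: S2R_iff)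
  then have "pdist X Z \<le> norm (?n X Y + ?n Y Z)"
    using assms sdist_bounds(1)[of "fst X" "fst Z"]
    by (auto simp: pdist_def norm_Pair S2R_iff intro!: power_mono)
  also have "\<dots> \<le> pdist X Y + pdist Y Z" using norm_triangle_ineq[of "?n X Y" "?n Y Z"] by (simp only: n)
  finally show ?thesis .
qed

section \<open>Area on the sphere\<close>

lemma geo_axis:
  "geo \<phi> \<theta> = (cos \<phi> * cos \<theta>) *\<^sub>R axis 1 1 + (sin \<phi> * cos \<theta>) *\<^sub>R axis 2 1 + sin \<theta> *\<^sub>R axis 3 1"
  by (simp add: geo_def vec_eq_iff forall_3 axis_def)

lemma geo_nth [simp]:
  "geo \<phi> \<theta> $ 1 = cos \<phi> * cos \<theta>" "geo \<phi> \<theta> $ 2 = sin \<phi> * cos \<theta>" "geo \<phi> \<theta> $ 3 = sin \<theta>"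
  by (simp_all add: geo_def)

lemma inner_geo:
  "geo \<beta> \<alpha> \<bullet> geo \<phi> \<theta> = cos \<alpha> * cos \<theta> * cos (\<phi> - \<beta>) + sin \<alpha> * sin \<theta>"
  by (simp add: inner_vec_def sum_3 cos_diff algebra_simps)

lemma norm_geo [simp]: "norm (geo \<phi> \<theta>) = 1"
  by (simp add: norm_eq_1 inner_geo power2_eq_square[symmetric])

lemma continuous_geo: "continuous_on A (\<lambda>(\<phi>, \<theta>). geo \<phi> \<theta>)"
  unfolding geo_axis split_beta by (intro continuous_intros)

lemma measurable_geo [measurable]: "(\<lambda>(\<phi>, \<theta>). geo \<phi> \<theta>) \<in> borel_measurable borel"
  by (intro borel_measurable_continuous_onI continuous_geo)

lemma measurable_geo' [measurable]:
  assumes [measurable]: "f \<in> borel_measurable M" "g \<in> borel_measurable M"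
  shows "(\<lambda>x. geo (f x) (g x)) \<in> borel_measurable M"
proof -
  have "(\<lambda>x. (\<lambda>(\<phi>, \<theta>). geo \<phi> \<theta>) (f x, g x)) \<in> borel_measurable M"
    by (rule measurable_compose[OF _ measurable_geo]) (simp add: borel_prod[symmetric])
  then show ?thesis by simp
qed

lemma unit_vector_geo:
  assumes "norm (P :: real^3) = 1"
  obtains \<beta> \<alpha> where "P = geo \<beta> \<alpha>"
proof -
  have 1: "(P$1)\<^sup>2 + (P$2)\<^sup>2 + (P$3)\<^sup>2 = 1"
    using assms by (simp add: norm_eq_1 inner_vec_def sum_3 power2_eq_square)
  then have z: "\<bar>P$3\<bar> \<le> 1"
    using abs_square_le_1[of "P$3"] by (smt (verit) zero_le_power2)
  define \<alpha> where "\<alpha> = arcsin (P$3)"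
  have sa: "sin \<alpha> = P$3" using z by (simp add: \<alpha>_def)
  show ?thesis
  proof (cases "cos \<alpha> = 0")
    case True
    then have "(P$3)\<^sup>2 = 1" using sin_cos_squared_add[of \<alpha>] sa by simp
    then have "P$1 = 0 \<and> P$2 = 0" using 1 by (simp add: sum_power2_eq_zero_iff)
    then have "P = geo 0 \<alpha>" using sa True by (simp add: vec_eq_iff forall_3)
    then show ?thesis using that by blast
  next
    case False
    have "(P$1 / cos \<alpha>)\<^sup>2 + (P$2 / cos \<alpha>)\<^sup>2 = 1"
      using 1 False sin_cos_squared_add[of \<alpha>] sa
      by (simp add: power_divide add_divide_distrib[symmetric])
    then obtain \<beta> where "P$1 / cos \<alpha> = cos \<beta>" "P$2 / cos \<alpha> = sin \<beta>"
      using sincos_total_2pi by metis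
    then have "P = geo \<beta> \<alpha>" using sa False by (simp add: vec_eq_iff forall_3 field_simps)
    then show ?thesis using that by blast
  qed
qed

definition sph_area :: "(real^3) measure" where
  "sph_area = distr
     (density lborel (\<lambda>(\<phi>, \<theta>). ennreal (cos \<theta>) * indicator ({-pi<..pi} \<times> {-pi/2..pi/2}) (\<phi>, \<theta>)))
     borel (\<lambda>(\<phi>, \<theta>). geo \<phi> \<theta>)"

lemma sets_sph_area [simp, measurable_cong]: "sets sph_area = sets borel"
  by (simp add: sph_area_def)

lemma space_sph_area [simp]: "space sph_area = UNIV"
  by (simp add: sph_area_def)

text \<open>The longitude is integrated first since the symmetries of the sphere that occur below act on the
  longitude alone.\<close>

lemma nn_integral_sph_area:
  assumes [measurable]: "f \<in> borel_measurable borel"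
  shows "(\<integral>\<^sup>+Q. f Q \<partial>sph_area) =
    (\<integral>\<^sup>+\<theta>. ennreal (cos \<theta>) * indicator {-pi/2..pi/2} \<theta> *
       (\<integral>\<^sup>+\<phi>. f (geo \<phi> \<theta>) * indicator {-pi<..pi} \<phi> \<partial>lborel) \<partial>lborel)"
proof -
  have m: "{-pi<..pi} \<times> {-pi/2..pi/2} \<in> sets (borel :: (real \<times> real) measure)"
    unfolding borel_prod[symmetric] by simp
  note [measurable] = m
  let ?g = "\<lambda>p::real\<times>real. ennreal (cos (snd p)) * indicator ({-pi<..pi} \<times> {-pi/2..pi/2}) p * f (geo (fst p) (snd p))"
  have g: "?g \<in> borel_measurable (borel :: (real \<times> real) measure)"
    unfolding borel_prod[symmetric] by measurable
  have g': "?g \<in> borel_measurable (lborel \<Otimes>\<^sub>M lborel)"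
    using g by (simp add: lborel_prod)
  have "(\<integral>\<^sup>+Q. f Q \<partial>sph_area) = (\<integral>\<^sup>+p. ?g p \<partial>lborel)"
  proof -
    define w :: "real \<times> real \<Rightarrow> ennreal"
      where "w = (\<lambda>p. ennreal (cos (snd p)) * indicator ({-pi<..pi} \<times> {-pi/2..pi/2}) p)"
    define G :: "real \<times> real \<Rightarrow> real^3" where "G = (\<lambda>p. geo (fst p) (snd p))"
    have wm: "w \<in> borel_measurable lborel"
      unfolding w_def lborel_prod[symmetric] by measurable
    have Gm: "G \<in> borel_measurable borel" using measurable_geo by (simp add: G_def split_beta')
    have eq: "sph_area = distr (density lborel w) borel G"
      by (simp add: sph_area_def w_def G_def split_beta')
    have "(\<integral>\<^sup>+Q. f Q \<partial>sph_area) = (\<integral>\<^sup>+p. f (G p) \<partial>density lborel w)"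
      unfolding eq using Gm by (intro nn_integral_distr) simp_all
    also have "\<dots> = (\<integral>\<^sup>+p. w p * f (G p) \<partial>lborel)"
      using Gm by (intro nn_integral_density[OF wm]) simp
    finally show ?thesis by (simp add: w_def G_def)
  qed
  also have "\<dots> = (\<integral>\<^sup>+p. ?g p \<partial>(lborel \<Otimes>\<^sub>M lborel))" by (simp add: lborel_prod)
  also have "\<dots> = (\<integral>\<^sup>+\<theta>. \<integral>\<^sup>+\<phi>. ?g (\<phi>, \<theta>) \<partial>lborel \<partial>lborel)"
    by (rule lborel_pair.nn_integral_snd[symmetric, OF g'])
  also have "\<dots> = (\<integral>\<^sup>+\<theta>. ennreal (cos \<theta>) * indicator {-pi/2..pi/2} \<theta> *
       (\<integral>\<^sup>+\<phi>. f (geo \<phi> \<theta>) * indicator {-pi<..pi} \<phi> \<partial>lborel) \<partial>lborel)"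
    by (intro nn_integral_cong, subst nn_integral_cmult[symmetric])
      (auto intro!: nn_integral_cong simp: indicator_def)
  finally show ?thesis .
qed

text \<open>Passing to the closed rectangle adds only the meridian \<open>\<phi> = - pi\<close>, and makes the calculus of
  integrals of continuous functions over boxes available.\<close>

lemma nn_integral_chart_continuous:
  fixes g :: "real \<Rightarrow> real \<Rightarrow> real"
  assumes g: "continuous_on (cbox (-pi, a) (pi, b)) (\<lambda>(\<phi>, \<theta>). g \<phi> \<theta>)"
    and nn: "\<And>\<phi> \<theta>. \<theta> \<in> {a..b} \<Longrightarrow> 0 \<le> g \<phi> \<theta>"
    and gm[measurable]: "(\<lambda>(\<phi>, \<theta>). g \<phi> \<theta>) \<in> borel_measurable borel"
  shows "(\<integral>\<^sup>+\<theta>. indicator {a..b} \<theta> * (\<integral>\<^sup>+\<phi>. ennreal (g \<phi> \<theta>) * indicator {-pi<..pi} \<phi> \<partial>lborel) \<partial>lborel)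
    = ennreal (integral (cbox (-pi, a) (pi, b)) (\<lambda>(\<phi>, \<theta>). g \<phi> \<theta>))"
proof -
  have m: "(\<lambda>p. ennreal (case p of (\<phi>, \<theta>) \<Rightarrow> g \<phi> \<theta>) * indicator (cbox (-pi, a) (pi, b)) p) \<in> borel_measurable (lborel \<Otimes>\<^sub>M lborel)"
    using gm by (simp add: lborel_prod)
  have "ennreal (integral (cbox (-pi, a) (pi, b)) (\<lambda>(\<phi>, \<theta>). g \<phi> \<theta>)) =
     (\<integral>\<^sup>+p. ennreal (case p of (\<phi>, \<theta>) \<Rightarrow> g \<phi> \<theta>) * indicator (cbox (-pi, a) (pi, b)) p \<partial>lborel)"
    by (rule nn_integral_has_integral_lebesgue'[symmetric])
      (use nn g in \<open>auto intro!: integrable_integral integrable_continuous\<close>)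
  also have "\<dots> = (\<integral>\<^sup>+p. ennreal (case p of (\<phi>, \<theta>) \<Rightarrow> g \<phi> \<theta>) * indicator (cbox (-pi, a) (pi, b)) p \<partial>(lborel \<Otimes>\<^sub>M lborel))"
    by (simp add: lborel_prod)
  also have "\<dots> = (\<integral>\<^sup>+\<theta>. \<integral>\<^sup>+\<phi>. ennreal (g \<phi> \<theta>) * indicator (cbox (-pi, a) (pi, b)) (\<phi>, \<theta>) \<partial>lborel \<partial>lborel)"
    by (subst lborel_pair.nn_integral_snd[symmetric, OF m]) simp
  also have "\<dots> = (\<integral>\<^sup>+\<theta>. indicator {a..b} \<theta> * (\<integral>\<^sup>+\<phi>. ennreal (g \<phi> \<theta>) * indicator {-pi<..pi} \<phi> \<partial>lborel) \<partial>lborel)"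
  proof (intro nn_integral_cong)
    fix \<theta> :: real
    have gt: "(\<lambda>\<phi>. g \<phi> \<theta>) \<in> borel_measurable borel"
      by (rule measurable_compose[OF _ gm, of "\<lambda>\<phi>. (\<phi>, \<theta>)", simplified]) (simp add: borel_prod[symmetric])
    note [measurable] = gt
    have "(\<integral>\<^sup>+\<phi>. ennreal (g \<phi> \<theta>) * indicator (cbox (-pi, a) (pi, b)) (\<phi>, \<theta>) \<partial>lborel)
      = (\<integral>\<^sup>+\<phi>. indicator {a..b} \<theta> * (ennreal (g \<phi> \<theta>) * indicator {-pi<..pi} \<phi>) \<partial>lborel)"
      by (rule nn_integral_cong_AE, rule AE_mp[OF AE_lborel_singleton[of "-pi"]])
        (auto simp: indicator_def cbox_Pair_eq intro!: AE_I2)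
    then show "(\<integral>\<^sup>+\<phi>. ennreal (g \<phi> \<theta>) * indicator (cbox (-pi, a) (pi, b)) (\<phi>, \<theta>) \<partial>lborel)
      = indicator {a..b} \<theta> * (\<integral>\<^sup>+\<phi>. ennreal (g \<phi> \<theta>) * indicator {-pi<..pi} \<phi> \<partial>lborel)"
      by (simp add: nn_integral_cmult)
  qed
  finally show ?thesis by simp
qed

lemma cos_nonneg_chart: "\<theta> \<in> {-pi/2..pi/2} \<Longrightarrow> 0 \<le> cos \<theta>"
  by (simp add: cos_ge_zero)

lemma nn_integral_sph_area_continuous:
  fixes h :: "real^3 \<Rightarrow> real"
  assumes h: "continuous_on UNIV h" and nn: "\<And>Q. 0 \<le> h Q"
  shows "(\<integral>\<^sup>+Q. h Q \<partial>sph_area) = ennreal (integral (cbox (-pi, -pi/2) (pi, pi/2)) (\<lambda>(\<phi>, \<theta>). cos \<theta> * h (geo \<phi> \<theta>)))"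
proof -
  have [measurable]: "h \<in> borel_measurable borel" by (rule borel_measurable_continuous_onI[OF h])
  have c: "continuous_on A (\<lambda>(\<phi>, \<theta>). cos \<theta> * h (geo \<phi> \<theta>))" for A
    unfolding split_beta
    by (intro continuous_intros continuous_on_compose2[OF h] continuous_geo[unfolded split_beta]) auto
  have "(\<integral>\<^sup>+Q. h Q \<partial>sph_area) = (\<integral>\<^sup>+\<theta>. indicator {-pi/2..pi/2} \<theta> *
       (\<integral>\<^sup>+\<phi>. ennreal (cos \<theta> * h (geo \<phi> \<theta>)) * indicator {-pi<..pi} \<phi> \<partial>lborel) \<partial>lborel)"
    apply (subst nn_integral_sph_area)
     apply simp
    apply (intro nn_integral_cong)
    apply (auto simp: indicator_def nn_integral_cmult[symmetric] ennreal_mult cos_ge_zero nn mult.assoc intro!: nn_integral_cong)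
    done
  also have "\<dots> = ennreal (integral (cbox (-pi, -pi/2) (pi, pi/2)) (\<lambda>(\<phi>, \<theta>). cos \<theta> * h (geo \<phi> \<theta>)))"
    by (intro nn_integral_chart_continuous c borel_measurable_continuous_onI mult_nonneg_nonneg nn cos_nonneg_chart)
  finally show ?thesis .
qed

text \<open>Differentiate with respect to the latitude \<open>\<alpha>\<close> of the centre. Moving the centre amounts to rotating
  the sphere, and the infinitesimal rotation preserves area: in the chart, the derivative of the
  integrand is minus the divergence of the vector field
  \<open>(sin (\<phi> - \<beta>) * sin \<theta> * F, cos (\<phi> - \<beta>) * cos \<theta> * F)\<close>. Its first component has period \<open>2 * pi\<close> in \<open>\<phi>\<close>, and
  the second one vanishes at the poles \<open>\<theta> = pi/2\<close> and \<open>\<theta> = - pi/2\<close>, so the divergence integrates to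
  zero.\<close>

lemma zonal_integral_independent:
  fixes F f :: "real \<Rightarrow> real"
  assumes F: "\<And>x. (F has_field_derivative f x) (at x)" and f: "continuous_on UNIV f"
  shows "integral (cbox (-pi, -pi/2) (pi, pi/2)) (\<lambda>(\<phi>, \<theta>). cos \<theta> * F (geo \<beta> \<alpha> \<bullet> geo \<phi> \<theta>)) =
    integral (cbox (-pi, -pi/2) (pi, pi/2)) (\<lambda>(\<phi>, \<theta>). cos \<theta> * F (geo \<beta> (pi/2) \<bullet> geo \<phi> \<theta>))"
proof -
  have Fc: "continuous_on UNIV F"
    using F by (meson DERIV_continuous_on has_field_derivative_at_within)
  note cF = continuous_on_compose2[OF Fc] and cf = continuous_on_compose2[OF f]
  \<comment> \<open>\<open>u\<close> is the inner product with the centre and \<open>w\<close> its derivative with respect to \<open>\<alpha>\<close>;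
    \<open>X\<close> and \<open>Y\<close> are the two summands of the divergence\<close>
  define u where "u = (\<lambda>\<alpha> \<phi> \<theta>. cos \<alpha> * cos \<theta> * cos (\<phi> - \<beta>) + sin \<alpha> * sin \<theta>)"
  define w where "w = (\<lambda>\<alpha> \<phi> \<theta>. - sin \<alpha> * cos \<theta> * cos (\<phi> - \<beta>) + cos \<alpha> * sin \<theta>)"
  let ?B = "cbox (-pi, -pi/2) (pi, pi/2) :: (real \<times> real) set"
  let ?G = "\<lambda>\<alpha>. integral ?B (\<lambda>(\<phi>, \<theta>). cos \<theta> * F (u \<alpha> \<phi> \<theta>))"
  have zero: "integral ?B (\<lambda>(\<phi>, \<theta>). cos \<theta> * (f (u \<alpha> \<phi> \<theta>) * w \<alpha> \<phi> \<theta>)) = 0" for \<alpha>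
  proof -
    define X where "X = (\<lambda>\<phi> \<theta>. cos (\<phi> - \<beta>) * sin \<theta> * F (u \<alpha> \<phi> \<theta>)
        + sin (\<phi> - \<beta>) * sin \<theta> * (f (u \<alpha> \<phi> \<theta>) * (- cos \<alpha> * cos \<theta> * sin (\<phi> - \<beta>))))"
    define Y where "Y = (\<lambda>\<phi> \<theta>. - cos (\<phi> - \<beta>) * sin \<theta> * F (u \<alpha> \<phi> \<theta>)
        + cos (\<phi> - \<beta>) * cos \<theta> * (f (u \<alpha> \<phi> \<theta>) * (- cos \<alpha> * sin \<theta> * cos (\<phi> - \<beta>) + sin \<alpha> * cos \<theta>)))"
    have Xc: "continuous_on A (\<lambda>(\<phi>, \<theta>). X \<phi> \<theta>)" for A
      unfolding X_def u_def split_beta by (intro continuous_intros cF cf) auto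
    have Yc: "continuous_on A (\<lambda>(\<phi>, \<theta>). Y \<phi> \<theta>)" for A
      unfolding Y_def u_def split_beta by (intro continuous_intros cF cf) auto
    have du: "((\<lambda>\<phi>. u \<alpha> \<phi> \<theta>) has_field_derivative (- cos \<alpha> * cos \<theta> * sin (\<phi> - \<beta>))) (at \<phi> within A)" for \<phi> \<theta> A
      unfolding u_def by (auto intro!: derivative_eq_intros)
    have dv: "((\<lambda>\<theta>. u \<alpha> \<phi> \<theta>) has_field_derivative (- cos \<alpha> * sin \<theta> * cos (\<phi> - \<beta>) + sin \<alpha> * cos \<theta>)) (at \<theta> within A)" for \<phi> \<theta> A
      unfolding u_def by (auto intro!: derivative_eq_intros)
    have FX: "((\<lambda>\<phi>. sin (\<phi> - \<beta>) * sin \<theta> * F (u \<alpha> \<phi> \<theta>)) has_field_derivative X \<phi> \<theta>) (at \<phi> within A)" for \<phi> \<theta> A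
      unfolding X_def by (rule derivative_eq_intros DERIV_chain2[OF F du] refl | simp)+
    have FY: "((\<lambda>\<theta>. cos (\<phi> - \<beta>) * cos \<theta> * F (u \<alpha> \<phi> \<theta>)) has_field_derivative Y \<phi> \<theta>) (at \<theta> within A)" for \<phi> \<theta> A
      unfolding Y_def by (rule derivative_eq_intros DERIV_chain2[OF F dv] refl | simp)+
    have X0: "integral (cbox (-pi) pi) (\<lambda>\<phi>. X \<phi> \<theta>) = 0" for \<theta>
    proof -
      have "((\<lambda>\<phi>. X \<phi> \<theta>) has_integral
          (sin (pi - \<beta>) * sin \<theta> * F (u \<alpha> pi \<theta>) - sin (-pi - \<beta>) * sin \<theta> * F (u \<alpha> (-pi) \<theta>))) {-pi..pi}"
        using FX by (intro fundamental_theorem_of_calculus)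
          (auto simp: has_real_derivative_iff_has_vector_derivative[symmetric])
      moreover have "sin (-pi - \<beta>) = sin (pi - \<beta>)" "u \<alpha> (-pi) \<theta> = u \<alpha> pi \<theta>"
        by (simp_all add: u_def sin_diff cos_diff)
      ultimately show ?thesis by (simp add: integral_unique)
    qed
    have Y0: "integral (cbox (-pi/2) (pi/2)) (\<lambda>\<theta>. Y \<phi> \<theta>) = 0" for \<phi>
    proof -
      have "((\<lambda>\<theta>. Y \<phi> \<theta>) has_integral
          (cos (\<phi> - \<beta>) * cos (pi/2) * F (u \<alpha> \<phi> (pi/2)) - cos (\<phi> - \<beta>) * cos (-pi/2) * F (u \<alpha> \<phi> (-pi/2)))) {-pi/2..pi/2}"
        using FY by (intro fundamental_theorem_of_calculus)
          (auto simp: has_real_derivative_iff_has_vector_derivative[symmetric])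
      then show ?thesis by (simp add: integral_unique)
    qed
    have XI: "integral ?B (\<lambda>(\<phi>, \<theta>). X \<phi> \<theta>) = 0"
    proof -
      have "integral ?B (\<lambda>(\<phi>, \<theta>). X \<phi> \<theta>) =
          integral (cbox (-pi) pi) (\<lambda>\<phi>. integral (cbox (-pi/2) (pi/2)) (\<lambda>\<theta>. X \<phi> \<theta>))"
        using integral_prod_continuous[OF Xc] by simp
      also have "\<dots> = integral (cbox (-pi/2) (pi/2)) (\<lambda>\<theta>. integral (cbox (-pi) pi) (\<lambda>\<phi>. X \<phi> \<theta>))"
        by (rule integral_swap_continuous[OF Xc])
      finally show ?thesis by (simp only: X0 integral_0)
    qed
    have YI: "integral ?B (\<lambda>(\<phi>, \<theta>). Y \<phi> \<theta>) = 0"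
    proof -
      have "integral ?B (\<lambda>(\<phi>, \<theta>). Y \<phi> \<theta>) =
          integral (cbox (-pi) pi) (\<lambda>\<phi>. integral (cbox (-pi/2) (pi/2)) (\<lambda>\<theta>. Y \<phi> \<theta>))"
        using integral_prod_continuous[OF Yc] by simp
      then show ?thesis by (simp only: Y0 integral_0)
    qed
    have "cos \<theta> * (f (u \<alpha> \<phi> \<theta>) * w \<alpha> \<phi> \<theta>) = - (X \<phi> \<theta> + Y \<phi> \<theta>)" for \<phi> \<theta>
    proof -
      have "X \<phi> \<theta> + Y \<phi> \<theta> = f (u \<alpha> \<phi> \<theta>) * cos \<theta> *
          (- cos \<alpha> * sin \<theta> * ((sin (\<phi> - \<beta>))\<^sup>2 + (cos (\<phi> - \<beta>))\<^sup>2) + sin \<alpha> * cos \<theta> * cos (\<phi> - \<beta>))"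
        unfolding X_def Y_def by algebra
      also have "\<dots> = - (cos \<theta> * (f (u \<alpha> \<phi> \<theta>) * w \<alpha> \<phi> \<theta>))"
        by (simp add: w_def algebra_simps)
      finally show ?thesis by simp
    qed
    then have "integral ?B (\<lambda>(\<phi>, \<theta>). cos \<theta> * (f (u \<alpha> \<phi> \<theta>) * w \<alpha> \<phi> \<theta>)) =
        integral ?B (\<lambda>p. - ((case p of (\<phi>, \<theta>) \<Rightarrow> X \<phi> \<theta>) + (case p of (\<phi>, \<theta>) \<Rightarrow> Y \<phi> \<theta>)))"
      by (simp add: split_beta')
    also have "\<dots> = - (integral ?B (\<lambda>(\<phi>, \<theta>). X \<phi> \<theta>) + integral ?B (\<lambda>(\<phi>, \<theta>). Y \<phi> \<theta>))"
      by (simp only: integral_neg integral_add[OF integrable_continuous[OF Xc] integrable_continuous[OF Yc]])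
    finally show ?thesis using XI YI by simp
  qed
  have "((\<lambda>\<alpha>. integral ?B (\<lambda>p. cos (snd p) * F (u \<alpha> (fst p) (snd p)))) has_field_derivative
      integral ?B (\<lambda>p. cos (snd p) * (f (u \<alpha> (fst p) (snd p)) * w \<alpha> (fst p) (snd p)))) (at \<alpha> within UNIV)" for \<alpha>
  proof (rule leibniz_rule_field_derivative[where U = UNIV])
    fix \<alpha> :: real and p :: "real \<times> real"
    have "((\<lambda>\<alpha>. u \<alpha> (fst p) (snd p)) has_field_derivative w \<alpha> (fst p) (snd p)) (at \<alpha> within UNIV)"
      unfolding u_def w_def by (auto intro!: derivative_eq_intros)
    then show "((\<lambda>\<alpha>. cos (snd p) * F (u \<alpha> (fst p) (snd p))) has_field_derivative
       cos (snd p) * (f (u \<alpha> (fst p) (snd p)) * w \<alpha> (fst p) (snd p))) (at \<alpha> within UNIV)"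
      using DERIV_cmult DERIV_chain2[OF F] by blast
    show "(\<lambda>p. cos (snd p) * F (u \<alpha> (fst p) (snd p))) integrable_on ?B"
      unfolding u_def by (intro integrable_continuous continuous_intros cF) auto
    show "continuous_on (UNIV \<times> ?B) (\<lambda>(\<alpha>, p). cos (snd p) * (f (u \<alpha> (fst p) (snd p)) * w \<alpha> (fst p) (snd p)))"
      unfolding u_def w_def split_beta by (intro continuous_intros cf) auto
  qed auto
  then have D: "DERIV ?G \<alpha> :> 0" for \<alpha>
    using zero by (simp add: split_beta')
  have "?G \<alpha> = ?G (pi/2)" by (rule DERIV_isconst_all) (use D in blast)
  then show ?thesis by (simp add: inner_geo u_def)
qed

lemma zonal_nn_integral_independent:
  fixes F f :: "real \<Rightarrow> real"
  assumes F: "\<And>x. (F has_field_derivative f x) (at x)" and f: "continuous_on UNIV f"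
    and nn: "\<And>x. 0 \<le> F x" and P: "norm P = 1"
  shows "(\<integral>\<^sup>+Q. F (P \<bullet> Q) \<partial>sph_area) = (\<integral>\<^sup>+Q. F (Q $ 3) \<partial>sph_area)"
proof -
  have Fc: "continuous_on UNIV F"
    using F by (meson DERIV_continuous_on has_field_derivative_at_within)
  obtain \<beta> \<alpha> where P: "P = geo \<beta> \<alpha>" using unit_vector_geo[OF P] .
  have h: "(\<integral>\<^sup>+Q. F (V \<bullet> Q) \<partial>sph_area) =
      ennreal (integral (cbox (-pi, -pi/2) (pi, pi/2)) (\<lambda>(\<phi>, \<theta>). cos \<theta> * F (V \<bullet> geo \<phi> \<theta>)))" for V
    by (intro nn_integral_sph_area_continuous continuous_on_compose2[OF Fc] continuous_intros nn) auto
  have "geo \<beta> (pi/2) \<bullet> Q = Q $ 3" for Q by (simp add: inner_vec_def sum_3)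
  then show ?thesis
    using h[of P] h[of "geo \<beta> (pi/2)"] zonal_integral_independent[OF F f, of \<beta> \<alpha>] by (simp add: P)
qed

lemma integral_cos_chart:
  assumes "a \<le> pi/2"
  shows "integral (cbox (-pi, a) (pi, pi/2)) (\<lambda>(\<phi>, \<theta>). cos \<theta>) = 2 * pi * (1 - sin a)"
proof -
  have c: "continuous_on (cbox (-pi, a) (pi, pi/2)) (\<lambda>(\<phi>::real, \<theta>). cos \<theta> :: real)"
    unfolding split_beta by (intro continuous_intros)
  have "(cos has_integral (sin (pi/2) - sin a)) {a..pi/2}"
    using assms by (intro fundamental_theorem_of_calculus)
      (auto simp: has_real_derivative_iff_has_vector_derivative[symmetric] intro!: derivative_eq_intros)
  then have "integral {a..pi/2} cos = 1 - sin a" by (simp add: integral_unique)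
  then show ?thesis using integral_prod_continuous[OF c] by (simp add: mult.commute)
qed

lemma emeasure_sph_area_UNIV: "emeasure sph_area UNIV = ennreal (4 * pi)"
proof -
  have "emeasure sph_area UNIV = (\<integral>\<^sup>+Q. ennreal 1 \<partial>sph_area)" by simp
  also have "\<dots> = ennreal (integral (cbox (-pi, -pi/2) (pi, pi/2)) (\<lambda>(\<phi>, \<theta>). cos \<theta> * 1))"
    by (rule nn_integral_sph_area_continuous) auto
  finally show ?thesis using integral_cos_chart[of "-pi/2"] by simp
qed

interpretation sph_area: finite_measure sph_area
  by standard (simp add: emeasure_sph_area_UNIV)

text \<open>The indicator of \<open>{c..}\<close> is the pointwise limit of the functions
  \<open>exp (- n * (max 0 (c - x))\<^sup>2)\<close>. They are continuously differentiable, since the square of the positive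
  part is, so that the invariance of zonal integrals applies to them and passes to the limit.\<close>

lemma emeasure_cap_independent:
  assumes P: "norm P = 1"
  shows "emeasure sph_area {Q. c \<le> P \<bullet> Q} = emeasure sph_area {Q. c \<le> Q $ 3}"
proof -
  define F where "F = (\<lambda>n x. exp (- (real n * (max 0 (c - x))\<^sup>2)))"
  define f where "f = (\<lambda>n x. exp (- (real n * (max 0 (c - x))\<^sup>2)) * (real n * (2 * max 0 (c - x))))"
  have sq: "((\<lambda>x. (max 0 (c - x))\<^sup>2) has_field_derivative - (2 * max 0 (c - x))) (at x)" for x :: real
  proof -
    have "((\<lambda>x. (max 0 x)\<^sup>2) has_field_derivative 2 * max 0 y) (at y)" for y :: real
    proof (cases y "0 :: real" rule: linorder_cases)
      case less
      have "((\<lambda>x. 0) has_field_derivative 2 * max 0 y) (at y)" using less by simp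
      moreover have "\<forall>\<^sub>F x in nhds y. (max 0 x)\<^sup>2 = 0"
        using less by (intro eventually_nhds_in_open[of "{..<0}", THEN eventually_mono]) auto
      ultimately show ?thesis by (subst DERIV_cong_ev[OF refl _ refl])
    next
      case greater
      have "((\<lambda>x. x\<^sup>2) has_field_derivative 2 * max 0 y) (at y)"
        using greater by (auto intro!: derivative_eq_intros)
      moreover have "\<forall>\<^sub>F x in nhds y. (max 0 x)\<^sup>2 = x\<^sup>2"
        using greater by (intro eventually_nhds_in_open[of "{0<..}", THEN eventually_mono]) auto
      ultimately show ?thesis by (subst DERIV_cong_ev[OF refl _ refl])
    next
      case equal
      have "(\<lambda>h. ((max 0 (0 + h))\<^sup>2 - (max 0 0)\<^sup>2) / h) \<midarrow>0\<rightarrow> (0::real)"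
      proof (rule Lim_null_comparison)
        show "\<forall>\<^sub>F h in at 0. norm (((max 0 (0 + h))\<^sup>2 - (max 0 0)\<^sup>2) / h) \<le> \<bar>h\<bar>" for h :: real
          by (intro always_eventually) (auto simp: max_def power2_eq_square)
        show "(\<lambda>h::real. \<bar>h\<bar>) \<midarrow>0\<rightarrow> 0" by (auto intro!: tendsto_eq_intros)
      qed
      then show ?thesis using equal by (simp add: DERIV_def)
    qed
    moreover have "((\<lambda>x. c - x) has_field_derivative -1) (at x)"
      by (auto intro!: derivative_eq_intros)
    ultimately show ?thesis using DERIV_chain2 by fastforce
  qed
  have F: "(F n has_field_derivative f n x) (at x)" for n x
    unfolding F_def f_def by (rule derivative_eq_intros sq refl | simp)+
  have f: "continuous_on UNIV (f n)" for n
    unfolding f_def by (intro continuous_intros)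
  have Fm: "(\<lambda>Q. ennreal (F n (V \<bullet> Q))) \<in> borel_measurable sph_area" for n and V :: "real^3"
    unfolding F_def by measurable
  have lim: "(\<lambda>n. F n x) \<longlonglongrightarrow> indicator {x. c \<le> x} x" for x
  proof (cases "c \<le> x")
    case True
    then show ?thesis by (simp add: F_def)
  next
    case False
    then have "F n x = exp (- (c - x)\<^sup>2) ^ n" for n
      by (simp add: F_def exp_of_nat_mult[symmetric] mult.commute)
    moreover have "(\<lambda>n. exp (- (c - x)\<^sup>2) ^ n) \<longlonglongrightarrow> 0" using False by (intro LIMSEQ_realpow_zero) auto
    ultimately show ?thesis using False by simp
  qed
  have conv: "(\<lambda>n. \<integral>\<^sup>+Q. F n (V \<bullet> Q) \<partial>sph_area) \<longlonglongrightarrow> emeasure sph_area {Q. c \<le> V \<bullet> Q}" for V :: "real^3"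
  proof -
    have "(\<lambda>n. \<integral>\<^sup>+Q. ennreal (F n (V \<bullet> Q)) \<partial>sph_area) \<longlonglongrightarrow> (\<integral>\<^sup>+Q. indicator {Q. c \<le> V \<bullet> Q} Q \<partial>sph_area)"
    proof (rule nn_integral_dominated_convergence[where w = "\<lambda>_. 1"])
      show "AE Q in sph_area. (\<lambda>n. ennreal (F n (V \<bullet> Q))) \<longlonglongrightarrow> indicator {Q. c \<le> V \<bullet> Q} Q"
      proof (intro AE_I2)
        show "(\<lambda>n. ennreal (F n (V \<bullet> Q))) \<longlonglongrightarrow> indicator {Q. c \<le> V \<bullet> Q} Q" for Q
          using tendsto_ennrealI[OF lim, of "V \<bullet> Q"] by (cases "c \<le> V \<bullet> Q") simp_all
      qed
      show "AE Q in sph_area. ennreal (F n (V \<bullet> Q)) \<le> 1" for n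
        by (intro AE_I2) (simp add: F_def)
    qed (use Fm in \<open>auto simp: emeasure_sph_area_UNIV\<close>)
    then show ?thesis by simp
  qed
  have "(\<integral>\<^sup>+Q. F n (P \<bullet> Q) \<partial>sph_area) = (\<integral>\<^sup>+Q. F n (axis 3 1 \<bullet> Q) \<partial>sph_area)" for n
    using zonal_nn_integral_independent[OF F f _ P, of n]
    by (simp add: inner_axis' F_def)
  then have "emeasure sph_area {Q. c \<le> P \<bullet> Q} = emeasure sph_area {Q. c \<le> axis 3 1 \<bullet> Q}"
    using conv[of P] conv[of "axis 3 1"] LIMSEQ_unique by simp
  then show ?thesis by (simp add: inner_axis')
qed

text \<open>By the preceding lemma the centre may be moved to the pole, where the cap is the rectangle
  \<open>\<theta> \<ge> pi/2 - r\<close> of the chart.\<close>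

lemma emeasure_cap:
  assumes P: "norm P = 1" and r: "0 \<le> r" "r \<le> pi"
  shows "emeasure sph_area {Q. cos r \<le> P \<bullet> Q} = ennreal (2 * pi * (1 - cos r))"
proof -
  have iff: "cos r \<le> sin \<theta> \<longleftrightarrow> pi/2 - r \<le> \<theta>" if "\<theta> \<in> {-pi/2..pi/2}" for \<theta>
    using that r cos_mono_le_eq[of r "pi/2 - \<theta>"] by (auto simp: cos_diff)
  have "emeasure sph_area {Q. cos r \<le> Q $ 3} = (\<integral>\<^sup>+Q. indicator {Q. cos r \<le> Q $ 3} Q \<partial>sph_area)" by simp
  also have "\<dots> = (\<integral>\<^sup>+\<theta>. ennreal (cos \<theta>) * indicator {-pi/2..pi/2} \<theta> *
       (\<integral>\<^sup>+\<phi>. indicator {Q. cos r \<le> Q $ 3} (geo \<phi> \<theta>) * indicator {-pi<..pi} \<phi> \<partial>lborel) \<partial>lborel)"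
    by (rule nn_integral_sph_area) measurable
  also have "\<dots> = (\<integral>\<^sup>+\<theta>. indicator {pi/2-r..pi/2} \<theta> * (\<integral>\<^sup>+\<phi>. ennreal (cos \<theta>) * indicator {-pi<..pi} \<phi> \<partial>lborel) \<partial>lborel)"
    using iff r by (intro nn_integral_cong) (auto simp: indicator_def nn_integral_cmult)
  also have "\<dots> = ennreal (integral (cbox (-pi, pi/2-r) (pi, pi/2)) (\<lambda>(\<phi>, \<theta>). cos \<theta>))"
    using r by (intro nn_integral_chart_continuous borel_measurable_continuous_onI cos_nonneg_chart)
      (auto simp: split_beta intro!: continuous_intros)
  also have "\<dots> = ennreal (2 * pi * (1 - cos r))" using integral_cos_chart[of "pi/2 - r"] r
    by (simp add: sin_diff)
  finally show ?thesis using emeasure_cap_independent[OF P] by simp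
qed

lemma emeasure_sph_area_sphere: "emeasure sph_area (- sphere 0 1) = 0"
  using nn_integral_sph_area[of "indicator (- sphere 0 1)"] by simp

lemma AE_sph_area: "AE Q in sph_area. norm Q = 1"
  by (rule AE_I[of _ _ "- sphere 0 1"]) (auto simp: emeasure_sph_area_sphere intro: borel_closed)

text \<open>Two opposite closed hemispheres cover the sphere and have half of its area each, which leaves
  nothing for their intersection.\<close>

lemma great_circle_null:
  assumes V: "norm V = 1"
  shows "emeasure sph_area {Q. V \<bullet> Q = 0} = 0" "emeasure sph_area {Q. 0 < V \<bullet> Q} = ennreal (2 * pi)"
proof -
  have A: "measure sph_area {Q. 0 \<le> V \<bullet> Q} = 2 * pi"
    using emeasure_cap[OF V, of "pi/2"] by (simp add: measure_def)
  have B: "measure sph_area {Q. V \<bullet> Q \<le> 0} = 2 * pi"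
    using emeasure_cap[of "- V" "pi/2"] V by (simp add: measure_def)
  have U: "measure sph_area UNIV = 4 * pi" by (simp add: measure_def emeasure_sph_area_UNIV)
  have C: "measure sph_area {Q. 0 < V \<bullet> Q} = 2 * pi"
  proof -
    have "{Q. 0 < V \<bullet> Q} = UNIV - {Q. V \<bullet> Q \<le> 0}" by auto
    then show ?thesis using sph_area.finite_measure_compl[of "{Q. V \<bullet> Q \<le> 0}"] B U by simp
  qed
  have "{Q. V \<bullet> Q = 0} = {Q. 0 \<le> V \<bullet> Q} - {Q. 0 < V \<bullet> Q}" by auto
  also have "measure sph_area \<dots> = measure sph_area {Q. 0 \<le> V \<bullet> Q} - measure sph_area {Q. 0 < V \<bullet> Q}"
    by (rule sph_area.finite_measure_Diff) auto
  finally show "emeasure sph_area {Q. V \<bullet> Q = 0} = 0" using A C by (simp add: sph_area.emeasure_eq_measure)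
  show "emeasure sph_area {Q. 0 < V \<bullet> Q} = ennreal (2 * pi)" using C by (simp add: sph_area.emeasure_eq_measure)
qed

section \<open>Riemannian volume\<close>

lemma sets_riem_vol [simp, measurable_cong]: "sets riem_vol = sets borel"
  by (simp add: riem_vol_def)

lemma space_riem_vol [simp]: "space riem_vol = UNIV"
  by (simp add: riem_vol_def)

lemma slice_measurable:
  fixes A :: "pt set"
  assumes "A \<in> sets borel"
  shows "{Q. (Q, t) \<in> A} \<in> sets borel"
proof -
  have "(\<lambda>Q. (Q, t)) -` A \<inter> space borel \<in> sets (borel :: (real^3) measure)"
    by (rule measurable_sets[OF _ assms]) (simp add: borel_prod[symmetric])
  then show ?thesis by (simp add: vimage_def)
qed

lemma emeasure_riem_vol:
  assumes A: "A \<in> sets borel"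
  shows "emeasure riem_vol A = (\<integral>\<^sup>+t. emeasure sph_area {Q. (Q, t) \<in> A} \<partial>lborel)"
proof -
  define C where "C = {-pi<..pi} \<times> {-pi/2..pi/2} \<times> (UNIV :: real set)"
  define w :: "real \<times> real \<times> real \<Rightarrow> ennreal"
    where "w = (\<lambda>p. ennreal (cos (fst (snd p))) * indicator C p)"
  define G :: "real \<times> real \<times> real \<Rightarrow> pt" where "G = (\<lambda>p. (geo (fst p) (fst (snd p)), snd (snd p)))"
  have Cm: "C \<in> sets (lborel \<Otimes>\<^sub>M (lborel \<Otimes>\<^sub>M lborel))"
    unfolding C_def by simp
  note [measurable] = Cm
  have wm': "w \<in> borel_measurable (lborel \<Otimes>\<^sub>M (lborel \<Otimes>\<^sub>M lborel))"
    unfolding w_def by measurable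
  have Gm': "G \<in> (lborel \<Otimes>\<^sub>M (lborel \<Otimes>\<^sub>M lborel)) \<rightarrow>\<^sub>M borel"
    unfolding G_def borel_prod[symmetric] by measurable
  have wm: "w \<in> borel_measurable lborel" and Gm: "G \<in> borel_measurable lborel"
    using wm' Gm' by (simp_all add: lborel_prod)
  have [measurable]: "A \<in> sets borel" by (rule A)
  have gm: "(\<lambda>p. w p * indicator A (G p)) \<in> borel_measurable (lborel \<Otimes>\<^sub>M (lborel \<Otimes>\<^sub>M lborel))"
    using wm' Gm' by measurable
  have eq: "riem_vol = distr (density lborel w) borel G"
    by (simp add: riem_vol_def w_def G_def C_def split_beta')
  have "emeasure riem_vol A = (\<integral>\<^sup>+X. indicator A X \<partial>riem_vol)" by (simp add: A)
  also have "\<dots> = (\<integral>\<^sup>+p. indicator A (G p) \<partial>density lborel w)"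
    unfolding eq using Gm by (intro nn_integral_distr) simp_all
  also have "\<dots> = (\<integral>\<^sup>+p. w p * indicator A (G p) \<partial>lborel)"
    using Gm by (intro nn_integral_density[OF wm]) simp
  also have "\<dots> = (\<integral>\<^sup>+p. w p * indicator A (G p) \<partial>(lborel \<Otimes>\<^sub>M (lborel \<Otimes>\<^sub>M lborel)))"
    by (simp add: lborel_prod)
  also have "\<dots> = (\<integral>\<^sup>+q. \<integral>\<^sup>+\<phi>. w (\<phi>, q) * indicator A (G (\<phi>, q)) \<partial>lborel \<partial>(lborel \<Otimes>\<^sub>M lborel))"
  proof -
    have "pair_sigma_finite (lborel :: real measure) (lborel \<Otimes>\<^sub>M lborel :: (real \<times> real) measure)"
      unfolding lborel_prod by unfold_locales
    then show ?thesis by (rule pair_sigma_finite.nn_integral_snd[OF _ gm, symmetric])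
  qed
  also have "\<dots> = (\<integral>\<^sup>+t. \<integral>\<^sup>+\<theta>. \<integral>\<^sup>+\<phi>. w (\<phi>, \<theta>, t) * indicator A (G (\<phi>, \<theta>, t)) \<partial>lborel \<partial>lborel \<partial>lborel)"
  proof (rule lborel_pair.nn_integral_snd[symmetric])
    have "(\<lambda>(q, \<phi>). w (\<phi>, q) * indicator A (G (\<phi>, q))) \<in> borel_measurable ((lborel \<Otimes>\<^sub>M lborel) \<Otimes>\<^sub>M lborel)"
      using measurable_pair_swap[OF gm] by (simp add: split_beta')
    then show "(\<lambda>q. \<integral>\<^sup>+\<phi>. w (\<phi>, q) * indicator A (G (\<phi>, q)) \<partial>lborel) \<in> borel_measurable (lborel \<Otimes>\<^sub>M lborel)"
      by (rule sigma_finite_measure.borel_measurable_nn_integral[OF sigma_finite_lborel])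
  qed
  also have "\<dots> = (\<integral>\<^sup>+t. emeasure sph_area {Q. (Q, t) \<in> A} \<partial>lborel)"
  proof (rule nn_integral_cong)
    fix t :: real
    have At: "{Q. (Q, t) \<in> A} \<in> sets borel" by (rule slice_measurable[OF A])
    note [measurable] = At
    have "emeasure sph_area {Q. (Q, t) \<in> A} = (\<integral>\<^sup>+Q. indicator {Q. (Q, t) \<in> A} Q \<partial>sph_area)"
      using At by simp
    also have "\<dots> = (\<integral>\<^sup>+\<theta>. ennreal (cos \<theta>) * indicator {-pi/2..pi/2} \<theta> *
       (\<integral>\<^sup>+\<phi>. indicator {Q. (Q, t) \<in> A} (geo \<phi> \<theta>) * indicator {-pi<..pi} \<phi> \<partial>lborel) \<partial>lborel)"
      by (rule nn_integral_sph_area) simp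
    also have "\<dots> = (\<integral>\<^sup>+\<theta>. \<integral>\<^sup>+\<phi>. w (\<phi>, \<theta>, t) * indicator A (G (\<phi>, \<theta>, t)) \<partial>lborel \<partial>lborel)"
      by (intro nn_integral_cong, subst nn_integral_cmult[symmetric])
        (auto intro!: nn_integral_cong simp: indicator_def w_def G_def C_def)
    finally show "(\<integral>\<^sup>+\<theta>. \<integral>\<^sup>+\<phi>. w (\<phi>, \<theta>, t) * indicator A (G (\<phi>, \<theta>, t)) \<partial>lborel \<partial>lborel)
      = emeasure sph_area {Q. (Q, t) \<in> A}" by simp
  qed
  finally show ?thesis .
qed

lemma indicator_swap_measurable:
  assumes A: "A \<in> sets (borel :: pt measure)"
  shows "(\<lambda>(t, Q). indicator A (Q, t) :: ennreal) \<in> borel_measurable (lborel \<Otimes>\<^sub>M sph_area)"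
proof -
  have "(\<lambda>(t, Q). (Q, t)) \<in> (lborel \<Otimes>\<^sub>M sph_area) \<rightarrow>\<^sub>M (borel :: pt measure)"
    unfolding borel_prod[symmetric] by measurable
  from measurable_compose[OF this borel_measurable_indicator[OF A]] show ?thesis by (simp add: split_beta')
qed

text \<open>The order of integration for sets that meet each fibre in few points.\<close>

lemma emeasure_riem_vol_fibres:
  assumes A: "A \<in> sets borel"
  shows "emeasure riem_vol A = (\<integral>\<^sup>+Q. emeasure lborel {t. (Q, t) \<in> A} \<partial>sph_area)"
proof -
  note m = indicator_swap_measurable[OF A]
  have t: "{t. (Q, t) \<in> A} \<in> sets borel" for Q
  proof -
    have "(\<lambda>t. (Q, t)) -` A \<inter> space borel \<in> sets (borel :: real measure)"
      by (rule measurable_sets[OF _ A]) (simp add: borel_prod[symmetric])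
    then show ?thesis by (simp add: vimage_def)
  qed
  have "emeasure riem_vol A = (\<integral>\<^sup>+t. \<integral>\<^sup>+Q. indicator {Q. (Q, t) \<in> A} Q \<partial>sph_area \<partial>lborel)"
    by (simp add: emeasure_riem_vol A slice_measurable)
  also have "\<dots> = (\<integral>\<^sup>+t. \<integral>\<^sup>+Q. indicator A (Q, t) \<partial>sph_area \<partial>lborel)" by (simp add: indicator_def)
  also have "\<dots> = (\<integral>\<^sup>+Q. \<integral>\<^sup>+t. indicator A (Q, t) \<partial>lborel \<partial>sph_area)"
  proof -
    have "pair_sigma_finite (lborel :: real measure) sph_area"
      by (simp add: pair_sigma_finite_def sigma_finite_lborel sph_area.sigma_finite_measure_axioms)
    from pair_sigma_finite.Fubini'[OF this m] show ?thesis by simp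
  qed
  also have "\<dots> = (\<integral>\<^sup>+Q. \<integral>\<^sup>+t. indicator {t. (Q, t) \<in> A} t \<partial>lborel \<partial>sph_area)" by (simp add: indicator_def)
  also have "\<dots> = (\<integral>\<^sup>+Q. emeasure lborel {t. (Q, t) \<in> A} \<partial>sph_area)" by (simp add: t)
  finally show ?thesis .
qed

lemma closed_S2R: "closed S2R"
  unfolding S2R_def by (intro closed_Times) auto

lemma continuous_on_pdist: "X \<in> S2R \<Longrightarrow> continuous_on S2R (pdist X)"
  unfolding pdist_def sdist_def
  by (intro continuous_intros) (auto simp: S2R_iff inner_sphere_bounds)

lemma gball_eq: "K \<in> S2R \<Longrightarrow> gball K \<rho> = {Q \<in> S2R. pdist K Q \<le> \<rho>}"
  by (auto simp: gball_def gdist_eq)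

lemma gball_measurable: "K \<in> S2R \<Longrightarrow> gball K \<rho> \<in> sets borel"
  unfolding gball_eq
  by (intro borel_closed continuous_on_closed_Collect_le continuous_on_pdist closed_S2R continuous_intros)

definition ball_vol :: "real \<Rightarrow> ennreal" where
  "ball_vol \<rho> = (\<integral>\<^sup>+t. ennreal (2 * pi * (1 - cos (sqrt (\<rho>\<^sup>2 - t\<^sup>2)))) * indicator {-\<rho>..\<rho>} t \<partial>lborel)"

text \<open>The section of the ball at height \<open>t\<close> above its centre is the spherical cap of radius
  \<open>sqrt (\<rho>\<^sup>2 - t\<^sup>2)\<close>. The bound \<open>\<rho> \<le> pi\<close> keeps these caps from wrapping around the sphere.\<close>

lemma emeasure_gball:
  assumes K: "K \<in> S2R" and \<rho>: "0 \<le> \<rho>" "\<rho> \<le> pi"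
  shows "emeasure riem_vol (gball K \<rho>) = ball_vol \<rho>"
proof -
  define P t0 where "P = fst K" and "t0 = snd K"
  have P: "norm P = 1" using K by (simp add: P_def S2R_iff)
  let ?g = "\<lambda>t. ennreal (2 * pi * (1 - cos (sqrt (\<rho>\<^sup>2 - t\<^sup>2)))) * indicator {-\<rho>..\<rho>} t"
  have slice: "emeasure sph_area {Q. (Q, t) \<in> gball K \<rho>} = ?g (t - t0)" for t
  proof (cases "t - t0 \<in> {-\<rho>..\<rho>}")
    case False
    have "{Q. (Q, t) \<in> gball K \<rho>} = {}"
    proof -
      have "\<rho> < \<bar>t - t0\<bar>" using False by auto
      also have "\<bar>t - t0\<bar> \<le> pdist K (Q, t)" for Q
        unfolding pdist_def t0_def by (rule real_le_rsqrt) simp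
      finally have "\<rho> < pdist K (Q, t)" for Q .
      then show ?thesis using K by (auto simp: gball_eq not_le[symmetric])
    qed
    then show ?thesis using False by simp
  next
    case True
    define r where "r = sqrt (\<rho>\<^sup>2 - (t - t0)\<^sup>2)"
    have t2: "(t - t0)\<^sup>2 \<le> \<rho>\<^sup>2" using True by (simp add: abs_le_square_iff[symmetric] abs_le_iff)
    have "r \<le> sqrt (\<rho>\<^sup>2)" unfolding r_def by (rule real_sqrt_le_mono) simp
    then have r: "0 \<le> r" "r \<le> pi" using \<rho> t2 by (auto simp: r_def)
    have iff: "(Q, t) \<in> gball K \<rho> \<longleftrightarrow> cos r \<le> P \<bullet> Q" if Q: "norm Q = 1" for Q
    proof -
      have "(Q, t) \<in> gball K \<rho> \<longleftrightarrow> sqrt ((sdist P Q)\<^sup>2 + (t - t0)\<^sup>2) \<le> \<rho>"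
        using K Q by (simp add: gball_eq S2R_iff pdist_def P_def t0_def)
      also have "\<dots> \<longleftrightarrow> (sdist P Q)\<^sup>2 + (t - t0)\<^sup>2 \<le> \<rho>\<^sup>2"
        using \<rho> by (auto intro: real_le_lsqrt dest: sqrt_le_D)
      also have "\<dots> \<longleftrightarrow> (sdist P Q)\<^sup>2 \<le> r\<^sup>2" using t2 by (auto simp: r_def)
      also have "\<dots> \<longleftrightarrow> sdist P Q \<le> r"
        using sdist_bounds(1)[OF P Q] r by (simp add: abs_le_square_iff[symmetric])
      also have "\<dots> \<longleftrightarrow> cos r \<le> P \<bullet> Q"
        using cos_mono_le_eq[of r "sdist P Q"] sdist_bounds[OF P Q] r by auto
      finally show ?thesis .
    qed
    have "emeasure sph_area {Q. (Q, t) \<in> gball K \<rho>} = emeasure sph_area {Q. cos r \<le> P \<bullet> Q}"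
    proof (rule emeasure_eq_AE)
      show "AE Q in sph_area. Q \<in> {Q. (Q, t) \<in> gball K \<rho>} \<longleftrightarrow> Q \<in> {Q. cos r \<le> P \<bullet> Q}"
        using AE_sph_area by eventually_elim (simp add: iff)
    qed (use slice_measurable[OF gball_measurable[OF K]] in auto)
    then show ?thesis using emeasure_cap[OF P r] True by (simp add: r_def)
  qed
  have "emeasure riem_vol (gball K \<rho>) = (\<integral>\<^sup>+t. ?g (t - t0) \<partial>lborel)"
    by (simp add: emeasure_riem_vol gball_measurable K slice)
  also have "\<dots> = (\<integral>\<^sup>+t. ?g t \<partial>lborel)"
    using nn_integral_real_affine[of ?g 1 "-t0"] by (simp add: algebra_simps)
  finally show ?thesis by (simp add: ball_vol_def)
qed

lemma one_minus_cos_scale: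
  assumes "0 \<le> l" "l \<le> 1" "0 \<le> x" "x \<le> pi/2"
  shows "1 - cos (l * x) \<le> l * (1 - cos x)"
proof -
  have "convex_on {0..pi/2} (\<lambda>x. 1 - cos x)"
  proof (rule f''_ge0_imp_convex)
    show "((\<lambda>x. 1 - cos x) has_field_derivative sin x) (at x)" for x :: real
      by (auto intro!: derivative_eq_intros)
    show "(sin has_field_derivative cos x) (at x)" for x :: real
      by (auto intro!: derivative_eq_intros)
  qed (auto intro: cos_ge_zero)
  from convex_onD[OF this, of l 0 x] show ?thesis using assms by simp
qed

text \<open>One factor \<open>l\<close> comes from the substitution \<open>t = l * s\<close> in the fibre, the other one from the
  convexity of \<open>1 - cos\<close>. The exponent two is what makes the final comparison of densities work.\<close>

lemma ball_vol_scale: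
  assumes "0 \<le> l" "l \<le> 1" "0 \<le> \<rho>" "\<rho> \<le> pi/2"
  shows "ball_vol (l * \<rho>) \<le> ennreal (l\<^sup>2) * ball_vol \<rho>"
proof (cases "l = 0")
  case True
  have "ball_vol 0 = (\<integral>\<^sup>+(t :: real). 0 \<partial>lborel)"
    unfolding ball_vol_def by (intro nn_integral_cong) (auto simp: indicator_def)
  then show ?thesis using True by simp
next
  case False
  then have l: "0 < l" using assms by simp
  let ?g = "\<lambda>t. ennreal (2 * pi * (1 - cos (sqrt (\<rho>\<^sup>2 - t\<^sup>2)))) * indicator {-\<rho>..\<rho>} t"
  have "ball_vol (l * \<rho>) = l * (\<integral>\<^sup>+t. ennreal (2 * pi * (1 - cos (sqrt ((l * \<rho>)\<^sup>2 - (l * t)\<^sup>2)))) * indicator {-(l * \<rho>)..l * \<rho>} (l * t) \<partial>lborel)"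
    unfolding ball_vol_def using l by (subst nn_integral_real_affine[where c = l and t = 0]) auto
  also have "\<dots> \<le> l * (\<integral>\<^sup>+t. ennreal l * ?g t \<partial>lborel)"
  proof (intro mult_left_mono nn_integral_mono)
    fix t :: real
    show "ennreal (2 * pi * (1 - cos (sqrt ((l * \<rho>)\<^sup>2 - (l * t)\<^sup>2)))) * indicator {-(l * \<rho>)..l * \<rho>} (l * t) \<le> ennreal l * ?g t"
    proof (cases "t \<in> {-\<rho>..\<rho>}")
      case False
      then have "l * t \<notin> {-(l * \<rho>)..l * \<rho>}"
        using l mult_le_cancel_left_pos[of l "-\<rho>" t] mult_le_cancel_left_pos[of l t \<rho>] by auto
      then show ?thesis by simp
    next
      case True
      define x where "x = sqrt (\<rho>\<^sup>2 - t\<^sup>2)"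
      have "t\<^sup>2 \<le> \<rho>\<^sup>2" using True by (simp add: abs_le_square_iff[symmetric] abs_le_iff)
      moreover have "x \<le> sqrt (\<rho>\<^sup>2)" unfolding x_def by (rule real_sqrt_le_mono) simp
      ultimately have x: "0 \<le> x" "x \<le> pi/2" using assms by (auto simp: x_def)
      have "sqrt ((l * \<rho>)\<^sup>2 - (l * t)\<^sup>2) = l * x"
      proof -
        have "(l * \<rho>)\<^sup>2 - (l * t)\<^sup>2 = l\<^sup>2 * (\<rho>\<^sup>2 - t\<^sup>2)" by (simp add: power_mult_distrib algebra_simps)
        then show ?thesis using l by (simp add: real_sqrt_mult x_def)
      qed
      moreover have "2 * pi * (1 - cos (l * x)) \<le> l * (2 * pi * (1 - cos x))"
        using mult_left_mono[OF one_minus_cos_scale[OF assms(1,2) x], of "2 * pi"] by (simp add: algebra_simps)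
      ultimately have "ennreal (2 * pi * (1 - cos (sqrt ((l * \<rho>)\<^sup>2 - (l * t)\<^sup>2)))) \<le> ennreal (l * (2 * pi * (1 - cos x)))"
        by (simp add: ennreal_leI)
      also have "\<dots> = ennreal l * ennreal (2 * pi * (1 - cos x))" using l by (simp add: ennreal_mult')
      finally show ?thesis using True by (auto simp: x_def indicator_def)
    qed
  qed simp
  also have "\<dots> = ennreal (l\<^sup>2) * ball_vol \<rho>"
    using l by (subst nn_integral_cmult) (auto simp: ball_vol_def power2_eq_square ennreal_mult mult.assoc)
  finally show ?thesis .
qed

lemma ball_vol_finite:
  assumes "0 \<le> \<rho>" shows "ball_vol \<rho> < \<infinity>"
proof -
  have "ball_vol \<rho> \<le> (\<integral>\<^sup>+t. ennreal (4 * pi) * indicator {-\<rho>..\<rho>} t \<partial>lborel)"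
    unfolding ball_vol_def
  proof (intro nn_integral_mono mult_right_mono ennreal_leI)
    fix t
    have "1 - cos (sqrt (\<rho>\<^sup>2 - t\<^sup>2)) \<le> 2"
      using cos_ge_minus_one[of "sqrt (\<rho>\<^sup>2 - t\<^sup>2)"] by linarith
    from mult_left_mono[OF this, of "2 * pi"]
    show "2 * pi * (1 - cos (sqrt (\<rho>\<^sup>2 - t\<^sup>2))) \<le> 4 * pi" by simp
  qed simp
  also have "\<dots> = ennreal (4 * pi) * ennreal (2 * \<rho>)"
    using assms by (subst nn_integral_cmult_indicator) auto
  also have "\<dots> < \<infinity>" by (simp add: ennreal_mult_less_top)
  finally show ?thesis .
qed

lemma measure_gball_scale:
  assumes "X \<in> S2R" "Y \<in> S2R" "0 \<le> r" "r \<le> R" "0 < R" "R \<le> pi/2"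
  shows "measure riem_vol (gball X r) \<le> (r / R)\<^sup>2 * measure riem_vol (gball Y R)"
proof -
  have f: "ball_vol R < \<infinity>" "ball_vol r < \<infinity>" using assms ball_vol_finite by auto
  have "ball_vol r \<le> ennreal ((r / R)\<^sup>2) * ball_vol R"
    using ball_vol_scale[of "r / R" R] assms by simp
  then have "enn2real (ball_vol r) \<le> enn2real (ennreal ((r / R)\<^sup>2) * ball_vol R)"
    using f by (intro enn2real_mono) (auto simp: ennreal_mult_less_top)
  then show ?thesis using assms by (simp add: measure_def emeasure_gball enn2real_mult)
qed

section \<open>The motions and their action on volume\<close>

definition flip :: "real \<Rightarrow> real \<Rightarrow> real^3 \<Rightarrow> real^3" where
  "flip a b P = vector [a * P $ 1, b * P $ 2, P $ 3]"

lemma flip_nth [simp]: "flip a b P $ 1 = a * P $ 1" "flip a b P $ 2 = b * P $ 2" "flip a b P $ 3 = P $ 3"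
  by (simp_all add: flip_def)

lemma flip_flip [simp]: "flip a b (flip c d P) = flip (a * c) (b * d) P"
  by (simp add: vec_eq_iff forall_3)

lemma flip_one [simp]: "flip 1 1 P = P"
  by (simp add: vec_eq_iff forall_3)

lemma flip_axis: "flip a b P = (a * P $ 1) *\<^sub>R axis 1 1 + (b * P $ 2) *\<^sub>R axis 2 1 + (P $ 3) *\<^sub>R axis 3 1"
  by (simp add: vec_eq_iff forall_3 axis_def)

lemma continuous_flip: "continuous_on A (flip a b)"
  unfolding flip_axis by (intro continuous_intros)

lemma flip_measurable [measurable]: "flip a b \<in> borel_measurable borel"
  by (intro borel_measurable_continuous_onI continuous_flip)

lemma inner_flip_flip:
  assumes "\<bar>a\<bar> = 1" "\<bar>b\<bar> = 1"
  shows "flip a b P \<bullet> flip a b Q = P \<bullet> Q"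
proof -
  have "a * a = 1" "b * b = 1" using assms by (auto simp: abs_if split: if_splits)
  then have "a * P $ 1 * (a * Q $ 1) = P $ 1 * Q $ 1" "b * P $ 2 * (b * Q $ 2) = P $ 2 * Q $ 2" by algebra+
  then show ?thesis by (simp only: inner_vec_def sum_3 flip_nth inner_real_def)
qed

lemma emeasure_sph_area_flip_y:
  assumes A[measurable]: "A \<in> sets borel"
  shows "emeasure sph_area (flip 1 (-1) -` A) = emeasure sph_area A"
proof -
  have geo: "flip 1 (-1) (geo \<phi> \<theta>) = geo (- \<phi>) \<theta>" for \<phi> \<theta>
    by (simp add: vec_eq_iff forall_3)
  have B: "flip 1 (-1) -` A \<in> sets borel" using measurable_sets[OF flip_measurable A] by simp
  have "emeasure sph_area (flip 1 (-1) -` A) = (\<integral>\<^sup>+Q. indicator A (flip 1 (-1) Q) \<partial>sph_area)"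
    using B by (simp add: nn_integral_indicator[symmetric] indicator_vimage del: nn_integral_indicator)
  also have "\<dots> = (\<integral>\<^sup>+\<theta>. ennreal (cos \<theta>) * indicator {-pi/2..pi/2} \<theta> *
       (\<integral>\<^sup>+\<phi>. indicator A (geo (- \<phi>) \<theta>) * indicator {-pi<..pi} \<phi> \<partial>lborel) \<partial>lborel)"
    by (subst nn_integral_sph_area) (auto simp: geo)
  also have "\<dots> = (\<integral>\<^sup>+\<theta>. ennreal (cos \<theta>) * indicator {-pi/2..pi/2} \<theta> *
       (\<integral>\<^sup>+\<phi>. indicator A (geo \<phi> \<theta>) * indicator {-pi<..pi} \<phi> \<partial>lborel) \<partial>lborel)"
  proof (rule nn_integral_cong, rule arg_cong2[where f = "(*)"], rule refl)
    fix \<theta> :: real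
    have "(\<integral>\<^sup>+\<phi>. indicator A (geo \<phi> \<theta>) * indicator {-pi<..pi} \<phi> \<partial>lborel) =
        (\<integral>\<^sup>+\<phi>. indicator A (geo (- \<phi>) \<theta>) * indicator {-pi<..pi} (- \<phi>) \<partial>lborel)"
      by (subst nn_integral_real_affine[where c = "-1" and t = 0]) auto
    also have "\<dots> = (\<integral>\<^sup>+\<phi>. indicator A (geo (- \<phi>) \<theta>) * indicator {-pi<..pi} \<phi> \<partial>lborel)"
      by (rule nn_integral_cong_AE, rule AE_mp[OF AE_lborel_singleton[of pi]], rule AE_mp[OF AE_lborel_singleton[of "-pi"]])
        (auto simp: indicator_def intro!: AE_I2)
    finally show "(\<integral>\<^sup>+\<phi>. indicator A (geo (- \<phi>) \<theta>) * indicator {-pi<..pi} \<phi> \<partial>lborel)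
        = (\<integral>\<^sup>+\<phi>. indicator A (geo \<phi> \<theta>) * indicator {-pi<..pi} \<phi> \<partial>lborel)" by simp
  qed
  also have "\<dots> = emeasure sph_area A"
    by (subst nn_integral_sph_area[symmetric]) auto
  finally show ?thesis .
qed

text \<open>The half turn is the shift of the longitude by \<open>pi\<close>. Modulo the period it exchanges the two halves
  \<open>{-pi<..0}\<close> and \<open>{0<..pi}\<close> of the chart.\<close>

lemma emeasure_sph_area_half_turn:
  assumes A[measurable]: "A \<in> sets borel"
  shows "emeasure sph_area (flip (-1) (-1) -` A) = emeasure sph_area A"
proof -
  have geo: "flip (-1) (-1) (geo \<phi> \<theta>) = geo (\<phi> + pi) \<theta>" for \<phi> \<theta>
    by (simp add: vec_eq_iff forall_3)
  have geo': "geo (\<phi> - pi) \<theta> = geo (\<phi> + pi) \<theta>" for \<phi> \<theta>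
    by (simp add: vec_eq_iff forall_3 cos_diff sin_diff)
  have B: "flip (-1) (-1) -` A \<in> sets borel" using measurable_sets[OF flip_measurable A] by simp
  have "emeasure sph_area (flip (-1) (-1) -` A) = (\<integral>\<^sup>+Q. indicator A (flip (-1) (-1) Q) \<partial>sph_area)"
    using B by (simp add: nn_integral_indicator[symmetric] indicator_vimage del: nn_integral_indicator)
  also have "\<dots> = (\<integral>\<^sup>+\<theta>. ennreal (cos \<theta>) * indicator {-pi/2..pi/2} \<theta> *
       (\<integral>\<^sup>+\<phi>. indicator A (geo (\<phi> + pi) \<theta>) * indicator {-pi<..pi} \<phi> \<partial>lborel) \<partial>lborel)"
    by (subst nn_integral_sph_area) (auto simp: geo)
  also have "\<dots> = (\<integral>\<^sup>+\<theta>. ennreal (cos \<theta>) * indicator {-pi/2..pi/2} \<theta> *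
       (\<integral>\<^sup>+\<phi>. indicator A (geo \<phi> \<theta>) * indicator {-pi<..pi} \<phi> \<partial>lborel) \<partial>lborel)"
  proof (rule nn_integral_cong, rule arg_cong2[where f = "(*)"], rule refl)
    fix \<theta> :: real
    let ?h = "\<lambda>\<phi>. indicator A (geo \<phi> \<theta>) :: ennreal"
    have split: "(\<integral>\<^sup>+\<phi>. f \<phi> * indicator {-pi<..pi} \<phi> \<partial>lborel) =
        (\<integral>\<^sup>+\<phi>. f \<phi> * indicator {-pi<..0} \<phi> \<partial>lborel) + (\<integral>\<^sup>+\<phi>. f \<phi> * indicator {0<..pi} \<phi> \<partial>lborel)"
      if [measurable]: "f \<in> borel_measurable borel" for f :: "real \<Rightarrow> ennreal"
      by (subst nn_integral_add[symmetric]) (auto intro!: nn_integral_cong simp: indicator_def)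
    have 1: "(\<integral>\<^sup>+\<phi>. ?h (\<phi> + pi) * indicator {-pi<..0} \<phi> \<partial>lborel) = (\<integral>\<^sup>+\<phi>. ?h \<phi> * indicator {0<..pi} \<phi> \<partial>lborel)"
      by (subst nn_integral_real_affine[where c = 1 and t = "-pi" ])
        (auto intro!: nn_integral_cong simp: indicator_def)
    have 2: "(\<integral>\<^sup>+\<phi>. ?h (\<phi> + pi) * indicator {0<..pi} \<phi> \<partial>lborel) = (\<integral>\<^sup>+\<phi>. ?h \<phi> * indicator {-pi<..0} \<phi> \<partial>lborel)"
      unfolding geo'[symmetric]
      by (subst nn_integral_real_affine[where c = 1 and t = "pi" ])
        (auto intro!: nn_integral_cong simp: indicator_def)
    show "(\<integral>\<^sup>+\<phi>. ?h (\<phi> + pi) * indicator {-pi<..pi} \<phi> \<partial>lborel) = (\<integral>\<^sup>+\<phi>. ?h \<phi> * indicator {-pi<..pi} \<phi> \<partial>lborel)"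
      by (simp add: split 1 2 add.commute)
  qed
  also have "\<dots> = emeasure sph_area A"
    by (subst nn_integral_sph_area[symmetric]) auto
  finally show ?thesis .
qed

lemma emeasure_sph_area_flip:
  assumes A: "A \<in> sets borel" and ab: "\<bar>a\<bar> = 1" "\<bar>b\<bar> = 1"
  shows "emeasure sph_area (flip a b -` A) = emeasure sph_area A"
proof -
  have A': "flip 1 (-1) -` A \<in> sets borel" using measurable_sets[OF flip_measurable A] by simp
  have "flip (-1) 1 -` A = flip (-1) (-1) -` (flip 1 (-1) -` A)" by (auto simp: vimage_def)
  then have "emeasure sph_area (flip (-1) 1 -` A) = emeasure sph_area A"
    using emeasure_sph_area_half_turn[OF A'] emeasure_sph_area_flip_y[OF A] by simp
  moreover have "a = 1 \<or> a = -1" "b = 1 \<or> b = -1" using ab by (auto simp: abs_if split: if_splits)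
  moreover have "flip 1 1 -` A = A" by auto
  ultimately show ?thesis
    using emeasure_sph_area_half_turn[OF A] emeasure_sph_area_flip_y[OF A] by metis
qed

definition parity_sign :: "int \<Rightarrow> real" where
  "parity_sign k = (if even k then 1 else -1)"

lemma parity_sign_simps [simp]: "parity_sign 0 = 1" "parity_sign 1 = -1" "parity_sign 2 = 1" "parity_sign (-1) = -1" "parity_sign k * parity_sign k = 1" "\<bar>parity_sign k\<bar> = 1"
    "parity_sign (- k) = parity_sign k" "parity_sign k * (parity_sign k * x) = x"
  by (auto simp: parity_sign_def)

lemma parity_sign_add: "parity_sign (j + k) = parity_sign j * parity_sign k"
  by (auto simp: parity_sign_def)

definition turn_sign :: "bool \<Rightarrow> real" where
  "turn_sign b = (if b then 1 else -1)"

lemma turn_sign_simps [simp]: "turn_sign True = 1" "turn_sign False = -1" "turn_sign b * turn_sign b = 1" "\<bar>turn_sign b\<bar> = 1" "turn_sign b * (turn_sign b * x) = x"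
  by (auto simp: turn_sign_def)

text \<open>For \<open>\<tau> > 0\<close> the index \<open>(b, k)\<close> enumerates the group without repetition:
  \<open>k\<close> counts the steps \<open>\<tau>\<close> in the fibre, and
  \<open>b\<close> selects one of the two sphere isometries that occur with the parity of \<open>k\<close>. The identity is
  \<open>(True, 0)\<close>, the half turn about the \<open>z\<close>-axis \<open>(False, 0)\<close>, and the reflections in \<open>y = 0\<close> and \<open>x = 0\<close> occur
  in \<open>(True, 1)\<close> and \<open>(False, 1)\<close>.\<close>

definition motion :: "real \<Rightarrow> bool \<times> int \<Rightarrow> pt \<Rightarrow> pt" where
  "motion \<tau> i X = (flip (turn_sign (fst i)) (turn_sign (fst i) * parity_sign (snd i)) (fst X), snd X + of_int (snd i) * \<tau>)"

lemma fst_motion: "fst (motion \<tau> i X) = flip (turn_sign (fst i)) (turn_sign (fst i) * parity_sign (snd i)) (fst X)"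
  and snd_motion: "snd (motion \<tau> i X) = snd X + of_int (snd i) * \<tau>"
  by (simp_all add: motion_def)

text \<open>All four sphere isometries are involutions, so only the shift has to be reversed.\<close>

definition motion_inv :: "bool \<times> int \<Rightarrow> bool \<times> int" where
  "motion_inv i = (fst i, - snd i)"

lemma motion_inv_motion [simp]: "motion \<tau> (motion_inv i) (motion \<tau> i X) = X"
  "motion \<tau> i (motion \<tau> (motion_inv i) X) = X"
  by (auto simp: motion_def motion_inv_def mult.assoc mult.left_commute intro!: prod_eqI)

lemma motion_motion: "motion \<tau> (b, j) (motion \<tau> (c, k) X) = motion \<tau> (b = c, j + k) X"
  by (cases b; cases c) (simp_all add: motion_def parity_sign_add algebra_simps)

lemma norm_flip: "\<bar>a\<bar> = 1 \<Longrightarrow> \<bar>b\<bar> = 1 \<Longrightarrow> norm (flip a b P) = norm P"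
  by (simp add: norm_eq_sqrt_inner inner_flip_flip)

lemma motion_S2R [simp]: "motion \<tau> i X \<in> S2R \<longleftrightarrow> X \<in> S2R"
  by (simp add: S2R_iff fst_motion norm_flip abs_mult)

lemma pdist_motion [simp]: "pdist (motion \<tau> i X) (motion \<tau> i Y) = pdist X Y"
  by (simp add: pdist_def sdist_def fst_motion snd_motion inner_flip_flip abs_mult)

lemma motion_measurable [measurable]: "motion \<tau> i \<in> borel_measurable borel"
  unfolding motion_def[abs_def]
  by (intro borel_measurable_continuous_onI continuous_intros continuous_on_compose2[OF continuous_flip]) auto

lemma emeasure_riem_vol_motion:
  assumes A: "A \<in> sets borel"
  shows "emeasure riem_vol (motion \<tau> i -` A) = emeasure riem_vol A"
proof -
  have B: "motion \<tau> i -` A \<in> sets borel" using measurable_sets[OF motion_measurable A] by simp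
  let ?h = "\<lambda>t. emeasure sph_area {Q. (Q, t) \<in> A}"
  have "emeasure sph_area {Q. (Q, t) \<in> motion \<tau> i -` A} = ?h (of_int (snd i) * \<tau> + 1 * t)" for t
  proof -
    have "{Q. (Q, t) \<in> motion \<tau> i -` A} =
      flip (turn_sign (fst i)) (turn_sign (fst i) * parity_sign (snd i)) -` {Q. (Q, of_int (snd i) * \<tau> + 1 * t) \<in> A}"
      by (auto simp: motion_def add.commute)
    then show ?thesis using emeasure_sph_area_flip[OF slice_measurable[OF A]] by (simp add: abs_mult)
  qed
  then have "emeasure riem_vol (motion \<tau> i -` A) = (\<integral>\<^sup>+t. ?h (of_int (snd i) * \<tau> + 1 * t) \<partial>lborel)"
    by (simp add: emeasure_riem_vol B)
  also have "\<dots> = (\<integral>\<^sup>+t. ?h t \<partial>lborel)"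
  proof -
    from sph_area.borel_measurable_nn_integral[OF indicator_swap_measurable[OF A]]
    have "(\<lambda>t. \<integral>\<^sup>+Q. indicator {Q. (Q, t) \<in> A} Q \<partial>sph_area) \<in> borel_measurable borel"
      by (simp add: indicator_def)
    then have "?h \<in> borel_measurable borel" by (simp add: slice_measurable[OF A])
    from nn_integral_real_affine[OF this, of 1] show ?thesis by simp
  qed
  also have "\<dots> = emeasure riem_vol A" by (simp add: emeasure_riem_vol A)
  finally show ?thesis .
qed

text \<open>The comparison of two fundamental domains. Here \<open>S i\<close> undoes \<open>T i\<close>; the translates of \<open>A\<close> cover
  \<open>B\<close>, and the translates of \<open>B\<close> are disjoint. Cut \<open>B\<close> into the pieces \<open>B \<inter> T i -` A\<close> and move each piece
  into \<open>A\<close>, where the pieces become disjoint.\<close>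

lemma tiling_emeasure_le:
  fixes T :: "'i::countable \<Rightarrow> 'a \<Rightarrow> 'a" and S :: "'i \<Rightarrow> 'a \<Rightarrow> 'a"
  assumes sp: "space M = UNIV" and A: "A \<in> sets M" and B: "B \<in> sets M"
    and Tm: "\<And>i. T i \<in> M \<rightarrow>\<^sub>M M" and Sm: "\<And>i. S i \<in> M \<rightarrow>\<^sub>M M"
    and pres: "\<And>i C. C \<in> sets M \<Longrightarrow> emeasure M (T i -` C) = emeasure M C"
    and ST: "\<And>i x. S i (T i x) = x"
    and cover: "\<And>x. x \<in> B \<Longrightarrow> \<exists>i. T i x \<in> A"
    and disj: "\<And>i j x. S i x \<in> B \<Longrightarrow> S j x \<in> B \<Longrightarrow> i = j"
  shows "emeasure M B \<le> emeasure M A"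
proof -
  have TA: "T i -` A \<in> sets M" for i using measurable_sets[OF Tm A] by (simp add: sp)
  have SB: "S i -` B \<in> sets M" for i using measurable_sets[OF Sm B] by (simp add: sp)
  have "emeasure M B = emeasure M (\<Union>i. B \<inter> T i -` A)"
    using cover by (intro arg_cong[where f = "emeasure M"]) auto
  also have "\<dots> \<le> (\<integral>\<^sup>+x. \<integral>\<^sup>+i. indicator (B \<inter> T i -` A) x \<partial>count_space UNIV \<partial>M)"
  proof -
    have "indicator (\<Union>i. B \<inter> T i -` A) x \<le> (\<integral>\<^sup>+i. indicator (B \<inter> T i -` A) x \<partial>count_space UNIV)" for x
    proof (cases "x \<in> (\<Union>i. B \<inter> T i -` A)")
      case True
      then obtain i where "x \<in> B \<inter> T i -` A" by blast
      then have "(\<integral>\<^sup>+j. indicator {i} j \<partial>count_space UNIV) \<le> (\<integral>\<^sup>+i. indicator (B \<inter> T i -` A) x \<partial>count_space UNIV)"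
        by (intro nn_integral_mono) (auto simp: indicator_def)
      then show ?thesis using True by simp
    qed simp
    then have "(\<integral>\<^sup>+x. indicator (\<Union>i. B \<inter> T i -` A) x \<partial>M) \<le> (\<integral>\<^sup>+x. \<integral>\<^sup>+i. indicator (B \<inter> T i -` A) x \<partial>count_space UNIV \<partial>M)"
      by (intro nn_integral_mono)
    moreover have "(\<Union>i. B \<inter> T i -` A) \<in> sets M" using TA B by auto
    ultimately show ?thesis by simp
  qed
  also have "\<dots> = (\<integral>\<^sup>+i. \<integral>\<^sup>+x. indicator (B \<inter> T i -` A) x \<partial>M \<partial>count_space UNIV)"
    using TA B by (intro nn_integral_count_space_nn_integral) auto
  also have "\<dots> = (\<integral>\<^sup>+i. emeasure M (S i -` B \<inter> A) \<partial>count_space UNIV)"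
  proof (rule nn_integral_cong)
    fix i
    have "B \<inter> T i -` A = T i -` (S i -` B \<inter> A)" using ST by auto
    then have "emeasure M (B \<inter> T i -` A) = emeasure M (S i -` B \<inter> A)"
      using pres[of "S i -` B \<inter> A" i] SB A by simp
    then show "(\<integral>\<^sup>+x. indicator (B \<inter> T i -` A) x \<partial>M) = emeasure M (S i -` B \<inter> A)" using TA B by simp
  qed
  also have "\<dots> = emeasure M (\<Union>i. S i -` B \<inter> A)"
    using SB A disj by (intro emeasure_UN_countable[symmetric]) (auto simp: disjoint_family_on_def)
  also have "\<dots> \<le> emeasure M A" using A SB by (intro emeasure_mono) auto
  finally show ?thesis .
qed

section \<open>The elements of the space group\<close>

declare split_paired_All [simp del] split_paired_Ex [simp del]

lemma isom_group_subgroup: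
  "subgroup {f \<in> Bij S2R. \<forall>X\<in>S2R. \<forall>Y\<in>S2R. gdist (f X) (f Y) = gdist X Y} (BijGroup S2R)"
proof
  show "{f \<in> Bij S2R. \<forall>X\<in>S2R. \<forall>Y\<in>S2R. gdist (f X) (f Y) = gdist X Y} \<subseteq> carrier (BijGroup S2R)"
    by (auto simp: BijGroup_def)
next
  fix f g assume "f \<in> {f \<in> Bij S2R. \<forall>X\<in>S2R. \<forall>Y\<in>S2R. gdist (f X) (f Y) = gdist X Y}"
    "g \<in> {f \<in> Bij S2R. \<forall>X\<in>S2R. \<forall>Y\<in>S2R. gdist (f X) (f Y) = gdist X Y}"
  then have fg: "f \<in> Bij S2R" "g \<in> Bij S2R"
      "\<And>X Y. X \<in> S2R \<Longrightarrow> Y \<in> S2R \<Longrightarrow> gdist (f X) (f Y) = gdist X Y"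
      "\<And>X Y. X \<in> S2R \<Longrightarrow> Y \<in> S2R \<Longrightarrow> gdist (g X) (g Y) = gdist X Y" by auto
  have "f \<otimes>\<^bsub>BijGroup S2R\<^esub> g = compose S2R f g" using fg by (simp add: BijGroup_def)
  moreover have "compose S2R f g \<in> Bij S2R" using fg by (intro compose_Bij)
  moreover have "gdist (compose S2R f g X) (compose S2R f g Y) = gdist X Y" if "X \<in> S2R" "Y \<in> S2R" for X Y
    using fg Bij_imp_funcset[OF fg(2)] that by (auto simp: compose_eq Pi_iff)
  ultimately show "f \<otimes>\<^bsub>BijGroup S2R\<^esub> g \<in> {f \<in> Bij S2R. \<forall>X\<in>S2R. \<forall>Y\<in>S2R. gdist (f X) (f Y) = gdist X Y}"
    by simp
next
  show "\<one>\<^bsub>BijGroup S2R\<^esub> \<in> {f \<in> Bij S2R. \<forall>X\<in>S2R. \<forall>Y\<in>S2R. gdist (f X) (f Y) = gdist X Y}"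
    by (auto simp: BijGroup_def id_Bij)
next
  fix f assume f: "f \<in> {f \<in> Bij S2R. \<forall>X\<in>S2R. \<forall>Y\<in>S2R. gdist (f X) (f Y) = gdist X Y}"
  then have bij: "f ` S2R = S2R" by (auto simp: Bij_def bij_betw_def)
  have "gdist (inv_into S2R f X) (inv_into S2R f Y) = gdist X Y" if "X \<in> S2R" "Y \<in> S2R" for X Y
  proof -
    have "inv_into S2R f X \<in> S2R" "inv_into S2R f Y \<in> S2R"
      using f that by (auto intro: Bij_inv_into_mem)
    then have "gdist (f (inv_into S2R f X)) (f (inv_into S2R f Y)) = gdist (inv_into S2R f X) (inv_into S2R f Y)"
      using f by blast
    then show ?thesis using that bij by (simp add: f_inv_into_f)
  qed
  then show "inv\<^bsub>BijGroup S2R\<^esub> f \<in> {f \<in> Bij S2R. \<forall>X\<in>S2R. \<forall>Y\<in>S2R. gdist (f X) (f Y) = gdist X Y}"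
    using f by (auto simp: inv_BijGroup restrict_inv_into_Bij)
qed

lemma group_isom_group: "group isom_group"
  unfolding isom_group_def by (rule group.subgroup_imp_group[OF group_BijGroup isom_group_subgroup])

text \<open>The group elements proper, which are extensional on \<^const>\<open>S2R\<close>.\<close>

definition smotion :: "real \<Rightarrow> bool \<times> int \<Rightarrow> pt \<Rightarrow> pt" where
  "smotion \<tau> i = restrict (motion \<tau> i) S2R"

lemma smotion_apply [simp]: "X \<in> S2R \<Longrightarrow> smotion \<tau> i X = motion \<tau> i X"
  by (simp add: smotion_def)

lemma smotion_Bij: "smotion \<tau> i \<in> Bij S2R"
proof -
  have "bij_betw (motion \<tau> i) S2R S2R"
    by (rule bij_betw_byWitness[where f' = "motion \<tau> (motion_inv i)"]) auto
  then show ?thesis unfolding Bij_def smotion_def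
    by (auto cong: bij_betw_cong)
qed

lemma smotion_isom: "smotion \<tau> i \<in> carrier isom_group"
  using smotion_Bij by (auto simp: isom_group_def gdist_eq)

lemma smotion_mult:
  "smotion \<tau> (b, j) \<otimes>\<^bsub>isom_group\<^esub> smotion \<tau> (c, k) = smotion \<tau> (b = c, j + k)"
proof -
  have "smotion \<tau> (b, j) \<otimes>\<^bsub>isom_group\<^esub> smotion \<tau> (c, k) = compose S2R (smotion \<tau> (b, j)) (smotion \<tau> (c, k))"
    by (simp add: isom_group_def BijGroup_def smotion_Bij)
  also have "\<dots> = smotion \<tau> (b = c, j + k)"
    by (auto simp: compose_def smotion_def motion_motion fun_eq_iff restrict_def)
  finally show ?thesis .
qed

lemma motion_id [simp]: "motion \<tau> (True, 0) X = X"
  by (simp add: motion_def)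

lemma smotion_one: "smotion \<tau> (True, 0) = \<one>\<^bsub>isom_group\<^esub>"
  by (auto simp: smotion_def isom_group_def BijGroup_def fun_eq_iff restrict_def)

lemma smotion_inv: "inv\<^bsub>isom_group\<^esub> (smotion \<tau> i) = smotion \<tau> (motion_inv i)"
  by (rule group.inv_equality[OF group_isom_group _ smotion_isom smotion_isom])
    (cases i; simp add: motion_inv_def smotion_mult smotion_one)

lemma lift_isom_smotion:
  "lift_isom refl1 \<tau> = smotion \<tau> (True, 1)" "lift_isom refl2 \<tau> = smotion \<tau> (False, 1)"
  "lift_isom id (2 * \<tau>) = smotion \<tau> (True, 2)"
  by (auto simp: lift_isom_def smotion_def motion_def refl1_def refl2_def flip_def vec_eq_iff forall_3 fun_eq_iff restrict_def)

text \<open>The motions are closed under products and inverses. Conversely \<open>(True, k)\<close> is a power of the first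
  generator, and \<open>(False, k)\<close> is the second generator times \<open>(True, k - 1)\<close>.\<close>

lemma carrier_space_group: "carrier (space_group \<tau>) = range (smotion \<tau>)"
proof -
  define H where "H = {smotion \<tau> (True, 1), smotion \<tau> (False, 1), smotion \<tau> (True, 2)}"
  have H: "carrier isom_group \<inter> H = H" by (auto simp: H_def smotion_isom)
  let ?G = "generate isom_group H"
  have c: "carrier (space_group \<tau>) = ?G"
    unfolding space_group_def carrier_subgroup_generated lift_isom_smotion H_def[symmetric] H ..
  have "f \<in> range (smotion \<tau>)" if "f \<in> ?G" for f
    using that
  proof induction
    case one
    then show ?case by (metis smotion_one rangeI)
  next
    case (incl h)
    then show ?case by (auto simp: H_def)
  next
    case (inv h)
    then show ?case by (auto simp: H_def smotion_inv)
  next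
    case (eng g h)
    then show ?case by (force simp: smotion_mult)
  qed
  moreover have "smotion \<tau> (b, k) \<in> ?G" for b k
  proof -
    have gen: "smotion \<tau> (True, 1) \<in> ?G" "smotion \<tau> (False, 1) \<in> ?G" "smotion \<tau> (True, -1) \<in> ?G"
      using generate.incl[of _ H isom_group] generate.inv[of "smotion \<tau> (True, 1)" H isom_group]
      by (auto simp: H_def smotion_inv motion_inv_def)
    have T: "smotion \<tau> (True, k) \<in> ?G" for k
    proof (induction k rule: int_induct[where k = 0])
      case base
      then show ?case using generate.one by (simp add: smotion_one)
    next
      case (step1 i)
      then show ?case using generate.eng[OF step1(2) gen(1)] by (simp add: smotion_mult add.commute)
    next
      case (step2 i)
      then show ?case using generate.eng[OF step2(2) gen(3)] by (simp add: smotion_mult)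
    qed
    have "smotion \<tau> (False, k) \<in> ?G" using generate.eng[OF gen(2) T[of "k - 1"]] by (simp add: smotion_mult)
    then show ?thesis using T by (cases b) auto
  qed
  ultimately show ?thesis unfolding c by auto
qed

lemma one_space_group: "\<one>\<^bsub>space_group \<tau>\<^esub> = smotion \<tau> (True, 0)"
  by (simp add: space_group_def subgroup_generated_def smotion_one)

lemma dv_cell_eq:
  assumes "K \<in> S2R"
  shows "dv_cell (space_group \<tau>) K = {X \<in> S2R. \<forall>i. pdist K X \<le> pdist (motion \<tau> i K) X}"
  using assms by (auto simp: dv_cell_def carrier_space_group gdist_eq)

text \<open>A trivial stabilizer excludes the poles of the sphere, which the half turn fixes. The comparison
  at a point of the equator shows that the half turn is not the identity.\<close>

lemma trivial_stabilizer_half_turn: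
  assumes "trivial_stabilizer (space_group \<tau>) K" and K: "K \<in> S2R"
  shows "motion \<tau> (False, 0) K \<noteq> K"
proof
  assume "motion \<tau> (False, 0) K = K"
  then have "smotion \<tau> (False, 0) \<in> stabilizer (space_group \<tau>) (\<lambda>g. g) K"
    using K by (simp add: stabilizer_def carrier_space_group)
  then have "smotion \<tau> (False, 0) = smotion \<tau> (True, 0)"
    using assms by (simp add: trivial_stabilizer_def one_space_group)
  moreover have E: "(geo 0 0, 0) \<in> S2R" by (simp add: S2R_iff)
  ultimately have "motion \<tau> (False, 0) (geo 0 0, 0) = motion \<tau> (True, 0) (geo 0 0, 0)"
    by (metis smotion_apply)
  then have "fst (motion \<tau> (False, 0) (geo 0 0, 0)) $ 1 = fst (motion \<tau> (True, 0) (geo 0 0, 0)) $ 1" by simp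
  then show False by (simp add: fst_motion)
qed

text \<open>A motion with a fixed point has no shift, and the half turn is the only nontrivial one without.\<close>

lemma motion_fixes_iff:
  assumes \<tau>: "0 < \<tau>" and h: "motion \<tau> (False, 0) K \<noteq> K"
  shows "motion \<tau> i K = K \<longleftrightarrow> i = (True, 0)"
proof
  assume m: "motion \<tau> i K = K"
  have "snd K + of_int (snd i) * \<tau> = snd K" by (metis m snd_motion)
  then have "snd i = 0" using \<tau> by simp
  then have "i = (True, 0) \<or> i = (False, 0)" by (cases i) auto
  then show "i = (True, 0)" using m h by blast
qed simp

lemma trivial_stabilizer_if_half_turn_moves:
  assumes \<tau>: "0 < \<tau>" and K: "K \<in> S2R" and h: "motion \<tau> (False, 0) K \<noteq> K"
  shows "trivial_stabilizer (space_group \<tau>) K"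
proof -
  have "stabilizer (space_group \<tau>) (\<lambda>g. g) K = {f \<in> range (smotion \<tau>). f K = K}"
    by (simp add: stabilizer_def carrier_space_group)
  also have "\<dots> = smotion \<tau> ` {i. motion \<tau> i K = K}" using K by auto
  also have "\<dots> = {smotion \<tau> (True, 0)}" unfolding motion_fixes_iff[OF \<tau> h] by simp
  finally show ?thesis by (simp add: trivial_stabilizer_def one_space_group)
qed

section \<open>The packing radius\<close>

lemma pdist_zero:
  assumes "X \<in> S2R" "Y \<in> S2R" "pdist X Y = 0"
  shows "X = Y"
proof -
  have n: "norm (fst X) = 1" "norm (fst Y) = 1" using assms by (auto simp: S2R_iff)
  have "sdist (fst X) (fst Y) = 0" "snd X = snd Y"
    using assms(3) by (auto simp: pdist_def sum_power2_eq_zero_iff)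
  then have "fst X \<bullet> fst Y = norm (fst X) * norm (fst Y)" using sdist_bounds(3)[OF n] n by simp
  then have "fst X = fst Y" using n norm_cauchy_schwarz_eq[of "fst X" "fst Y"] by simp
  then show ?thesis using \<open>snd X = snd Y\<close> by (rule prod_eqI)
qed

text \<open>If the radius is at most half the distance of the centre to each of its other images, the triangle
  inequality puts the ball into the cell. If it is larger than that for some image, the ball contains a point
  beyond the midpoint of a shortest segment to that image, and this point is outside the cell.\<close>

lemma gball_subset_dv_cell_iff:
  assumes K: "K \<in> S2R" and \<rho>: "0 \<le> \<rho>"
  shows "gball K \<rho> \<subseteq> dv_cell (space_group \<tau>) K \<longleftrightarrow>
    (\<forall>i. motion \<tau> i K \<noteq> K \<longrightarrow> 2 * \<rho> \<le> pdist K (motion \<tau> i K))"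
proof (intro iffI allI impI)
  fix i assume sub: "gball K \<rho> \<subseteq> dv_cell (space_group \<tau>) K" and ne: "motion \<tau> i K \<noteq> K"
  define d where "d = pdist K (motion \<tau> i K)"
  have "d \<noteq> 0" using pdist_zero[OF K, of "motion \<tau> i K"] K ne by (auto simp: d_def)
  then have d: "0 < d" using \<open>d \<noteq> 0\<close> pdist_nonneg[of K "motion \<tau> i K"] unfolding d_def by linarith
  show "2 * \<rho> \<le> pdist K (motion \<tau> i K)"
  proof (rule ccontr)
    assume "\<not> ?thesis"
    then have less: "d < 2 * \<rho>" by (simp add: d_def)
    \<comment> \<open>a point of the ball beyond the midpoint of the segment from the centre to its image\<close>
    obtain c where c: "c 0 = K" "c 1 = motion \<tau> i K" "\<And>u. c u \<in> S2R"
      "\<And>u w. u \<in> {0..1} \<Longrightarrow> w \<in> {0..1} \<Longrightarrow> pdist (c u) (c w) = \<bar>u - w\<bar> * d"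
      using minimal_geodesic_exists[OF K, of "motion \<tau> i K"] K unfolding d_def by (metis motion_S2R)
    define u where "u = min 1 (\<rho> / d)"
    have u: "u \<in> {0..1}" "1/2 < u" "u * d \<le> \<rho>"
      using less d \<rho> by (auto simp: u_def min_def field_simps)
    have "c u \<in> gball K \<rho>" using c(3) c(4)[of 0 u] u K by (simp add: gball_eq c(1))
    then have "pdist K (c u) \<le> pdist (motion \<tau> i K) (c u)" using sub K by (auto simp: dv_cell_eq)
    then have "u * d \<le> (1 - u) * d" using c(4)[of 0 u] c(4)[of 1 u] u by (simp add: c(1,2))
    then show False using d u by simp
  qed
next
  assume h: "\<forall>i. motion \<tau> i K \<noteq> K \<longrightarrow> 2 * \<rho> \<le> pdist K (motion \<tau> i K)"
  show "gball K \<rho> \<subseteq> dv_cell (space_group \<tau>) K"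
  proof
    fix X assume "X \<in> gball K \<rho>"
    then have X: "X \<in> S2R" "pdist K X \<le> \<rho>" using K by (auto simp: gball_eq)
    have "pdist K X \<le> pdist (motion \<tau> i K) X" for i
    proof (cases "motion \<tau> i K = K")
      case False
      then have "2 * \<rho> \<le> pdist K X + pdist X (motion \<tau> i K)"
        using h pdist_triangle[OF K X(1), of "motion \<tau> i K"] K by force
      then show ?thesis using X(2) by (simp add: pdist_commute)
    qed simp
    then show "X \<in> dv_cell (space_group \<tau>) K" using X K by (simp add: dv_cell_eq)
  qed
qed

text \<open>The admissible radii form a closed interval, so the supremum is attained and is the value of
  \<^const>\<open>Greatest\<close>.\<close>

lemma packing_radius_greatest:
  fixes K :: pt and \<tau> :: real
  assumes K: "K \<in> S2R"
  defines "P \<equiv> \<lambda>\<rho>. \<rho> \<in> {0..pi} \<and> (\<forall>i. motion \<tau> i K \<noteq> K \<longrightarrow> 2 * \<rho> \<le> pdist K (motion \<tau> i K))"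
  shows "P (packing_radius (space_group \<tau>) K)" "\<And>\<rho>. P \<rho> \<Longrightarrow> \<rho> \<le> packing_radius (space_group \<tau>) K"
proof -
  define s where "s = Sup (Collect P)"
  have P0: "P 0" by (simp add: P_def)
  have bdd: "bdd_above (Collect P)" by (rule bdd_aboveI[of _ pi]) (simp add: P_def)
  have le: "\<rho> \<le> s" if "P \<rho>" for \<rho> unfolding s_def using that bdd by (intro cSup_upper) auto
  have ne: "Collect P \<noteq> {}" using P0 by blast
  have "s \<le> pi" unfolding s_def by (intro cSup_least ne) (auto simp: P_def)
  moreover have "s \<le> pdist K (motion \<tau> i K) / 2" if "motion \<tau> i K \<noteq> K" for i
    unfolding s_def by (intro cSup_least ne) (use that in \<open>auto simp: P_def\<close>)
  ultimately have Ps: "P s" using le[OF P0] by (auto simp: P_def field_simps)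
  have "(\<rho> \<in> {0..pi} \<and> gball K \<rho> \<subseteq> dv_cell (space_group \<tau>) K) = P \<rho>" for \<rho>
    using gball_subset_dv_cell_iff[OF K, of \<rho> \<tau>] by (auto simp: P_def)
  then have "packing_radius (space_group \<tau>) K = Greatest P" by (simp add: packing_radius_def)
  also have "\<dots> = s" by (rule Greatest_equality) (use Ps le in auto)
  finally have "packing_radius (space_group \<tau>) K = s" .
  then show "P (packing_radius (space_group \<tau>) K)" "\<And>\<rho>. P \<rho> \<Longrightarrow> \<rho> \<le> packing_radius (space_group \<tau>) K"
    using Ps le by auto
qed

section \<open>The volume of the cell\<close>

lemma dv_cell_measurable: "K \<in> S2R \<Longrightarrow> dv_cell (space_group \<tau>) K \<in> sets borel"
proof -
  assume K: "K \<in> S2R"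
  have "closed {X \<in> S2R. pdist K X \<le> pdist (motion \<tau> i K) X}" for i
    using K by (intro continuous_on_closed_Collect_le continuous_on_pdist closed_S2R) auto
  then have "closed (\<Inter>i. {X \<in> S2R. pdist K X \<le> pdist (motion \<tau> i K) X})" by blast
  moreover have "dv_cell (space_group \<tau>) K = (\<Inter>i. {X \<in> S2R. pdist K X \<le> pdist (motion \<tau> i K) X})"
    using K by (auto simp: dv_cell_eq)
  ultimately show ?thesis by simp
qed

text \<open>A fundamental domain of the group, up to the plane \<open>y = 0\<close>: the condition on the fibre coordinate determines \<open>k\<close>, and the
  sign of \<open>y\<close> then determines \<open>b\<close>.\<close>

definition half_slab :: "real \<Rightarrow> pt set" where
  "half_slab \<tau> = {X \<in> S2R. 0 < fst X $ 2 \<and> snd X \<in> {0..<\<tau>}}"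

lemma half_slab_measurable: "half_slab \<tau> \<in> sets borel"
proof -
  have "half_slab \<tau> = S2R \<inter> ({X. 0 < fst X $ 2} \<inter> {X. 0 \<le> snd X}) \<inter> {X. snd X < \<tau>}"
    by (auto simp: half_slab_def)
  also have "\<dots> \<in> sets borel"
    by (intro sets.Int borel_closed borel_open closed_S2R open_Collect_less closed_Collect_le continuous_intros)
  finally show ?thesis .
qed

lemma emeasure_half_slab:
  assumes "0 < \<tau>" shows "emeasure riem_vol (half_slab \<tau>) = ennreal (2 * pi * \<tau>)"
proof -
  have "emeasure sph_area {Q. (Q, t) \<in> half_slab \<tau>} = ennreal (2 * pi) * indicator {0..<\<tau>} t" for t
  proof (cases "t \<in> {0..<\<tau>}")
    case True
    have "emeasure sph_area {Q. (Q, t) \<in> half_slab \<tau>} = emeasure sph_area {Q. 0 < axis 2 1 \<bullet> Q}"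
    proof (rule emeasure_eq_AE)
      show "AE Q in sph_area. Q \<in> {Q. (Q, t) \<in> half_slab \<tau>} \<longleftrightarrow> Q \<in> {Q. 0 < axis 2 1 \<bullet> Q}"
        using AE_sph_area by eventually_elim (use True in \<open>auto simp: half_slab_def S2R_iff inner_axis'\<close>)
    qed (use slice_measurable[OF half_slab_measurable] in auto)
    then show ?thesis using great_circle_null(2)[of "axis 2 1"] True by simp
  next
    case False
    then have "{Q. (Q, t) \<in> half_slab \<tau>} = {}" by (auto simp: half_slab_def)
    then show ?thesis using False by simp
  qed
  then have "emeasure riem_vol (half_slab \<tau>) = ennreal (2 * pi) * ennreal \<tau>"
    using assms by (simp add: emeasure_riem_vol[OF half_slab_measurable] nn_integral_cmult_indicator)
  then show ?thesis by (simp add: ennreal_mult')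
qed

text \<open>The distance is at least the difference of the fibre coordinates, so only finitely many images of
  \<open>K\<close> are as close to \<open>X\<close> as \<open>K\<close> itself.\<close>

lemma nearest_orbit_point:
  assumes \<tau>: "0 < \<tau>"
  shows "\<exists>i. \<forall>j. pdist (motion \<tau> i K) X \<le> pdist (motion \<tau> j K) X"
proof -
  let ?f = "\<lambda>i. pdist (motion \<tau> i K) X"
  define A where "A = {i. ?f i \<le> ?f (True, 0)}"
  have "A \<subseteq> UNIV \<times> {- \<lceil>(?f (True, 0) + \<bar>snd X - snd K\<bar>) / \<tau>\<rceil>..\<lceil>(?f (True, 0) + \<bar>snd X - snd K\<bar>) / \<tau>\<rceil>}"
  proof
    fix i assume "i \<in> A"
    obtain b k where i: "i = (b, k)" by (cases i)
    have "\<bar>snd X - snd (motion \<tau> i K)\<bar> \<le> ?f i"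
      unfolding pdist_def by (rule real_le_rsqrt) simp
    also have "\<dots> \<le> ?f (True, 0)" using \<open>i \<in> A\<close> by (simp add: A_def)
    finally have "\<bar>of_int k * \<tau>\<bar> \<le> ?f (True, 0) + \<bar>snd X - snd K\<bar>"
      by (simp add: snd_motion i)
    then have "\<bar>of_int k\<bar> \<le> (?f (True, 0) + \<bar>snd X - snd K\<bar>) / \<tau>"
      using \<tau> by (simp add: abs_mult field_simps)
    then have "\<bar>of_int k\<bar> \<le> (of_int \<lceil>(?f (True, 0) + \<bar>snd X - snd K\<bar>) / \<tau>\<rceil> :: real)"
      using le_of_int_ceiling order_trans by blast
    then have "\<bar>k\<bar> \<le> \<lceil>(?f (True, 0) + \<bar>snd X - snd K\<bar>) / \<tau>\<rceil>" by linarith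
    then show "i \<in> UNIV \<times> {- \<lceil>(?f (True, 0) + \<bar>snd X - snd K\<bar>) / \<tau>\<rceil>..\<lceil>(?f (True, 0) + \<bar>snd X - snd K\<bar>) / \<tau>\<rceil>}"
      by (auto simp: i)
  qed
  then have "finite A" by (rule finite_subset) auto
  moreover have "(True, 0) \<in> A" by (simp add: A_def)
  ultimately obtain i where i: "i \<in> A" "\<And>j. j \<in> A \<Longrightarrow> ?f i \<le> ?f j"
    using arg_min_if_finite[of A ?f] by (metis empty_iff not_le)
  have "?f i \<le> ?f j" for j
    using i by (cases "j \<in> A") (auto simp: A_def)
  then show ?thesis by blast
qed

lemma pdist_motion_inv: "pdist K (motion \<tau> (motion_inv i) X) = pdist (motion \<tau> i K) X"
  using pdist_motion[of \<tau> i K "motion \<tau> (motion_inv i) X"] by simp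

lemma half_slab_unique:
  assumes \<tau>: "0 < \<tau>" and "motion \<tau> i X \<in> half_slab \<tau>" "motion \<tau> j X \<in> half_slab \<tau>"
  shows "i = j"
proof -
  obtain b k c l where ij: "i = (b, k)" "j = (c, l)" by (cases i, cases j)
  have "snd X + of_int k * \<tau> \<in> {0..<\<tau>}" "snd X + of_int l * \<tau> \<in> {0..<\<tau>}"
    using assms by (auto simp: half_slab_def ij snd_motion)
  then have "\<bar>of_int k * \<tau> - of_int l * \<tau>\<bar> < 1 * \<tau>" by auto
  then have "\<bar>of_int (k - l) :: real\<bar> < 1" using \<tau>
    by (simp only: left_diff_distrib[symmetric] abs_mult of_int_diff) simp
  then have kl: "k = l" by linarith
  have "0 < turn_sign b * parity_sign k * fst X $ 2" "0 < turn_sign c * parity_sign k * fst X $ 2"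
    using assms by (auto simp: half_slab_def ij fst_motion kl)
  then have "b = c" by (cases b; cases c) auto
  then show ?thesis using kl ij by simp
qed

lemma half_slab_cover:
  assumes \<tau>: "0 < \<tau>" and X: "X \<in> S2R" "fst X $ 2 \<noteq> 0"
  shows "\<exists>i. motion \<tau> i X \<in> half_slab \<tau>"
proof -
  define k where "k = - \<lfloor>snd X / \<tau>\<rfloor>"
  have t: "snd X + of_int k * \<tau> \<in> {0..<\<tau>}"
    using floor_divide_lower[OF \<tau>, of "snd X"] floor_divide_upper[OF \<tau>, of "snd X"]
    by (simp add: k_def distrib_right)
  define y where "y = parity_sign k * fst X $ 2"
  have "y \<noteq> 0" using X by (simp add: y_def parity_sign_def)
  define b where "b \<longleftrightarrow> 0 < y"
  have "0 < turn_sign b * y" using \<open>y \<noteq> 0\<close> by (auto simp: turn_sign_def b_def)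
  then have "0 < turn_sign b * parity_sign k * fst X $ 2" by (simp add: y_def mult.assoc)
  then have "motion \<tau> (b, k) X \<in> half_slab \<tau>" using t X by (simp add: half_slab_def fst_motion snd_motion)
  then show ?thesis by blast
qed

text \<open>If the fibre coordinates of \<open>K\<close> and \<open>L\<close> differ, the quadratic terms in \<open>t\<close> cancel in the equation of
  the bisector, which becomes linear in \<open>t\<close>, so that each fibre meets the bisector at most once. If
  they agree, each horizontal section of the bisector is part of a great circle.\<close>

lemma bisector_null:
  assumes K: "K \<in> S2R" and L: "L \<in> S2R" and ne: "K \<noteq> L"
  shows "{X \<in> S2R. pdist K X = pdist L X} \<in> null_sets riem_vol"
proof -
  let ?A = "{X \<in> S2R. pdist K X = pdist L X}"
  have "closed {X \<in> S2R. pdist K X \<le> pdist L X}" "closed {X \<in> S2R. pdist L X \<le> pdist K X}"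
    by (intro continuous_on_closed_Collect_le continuous_on_pdist closed_S2R K L)+
  then have "closed ({X \<in> S2R. pdist K X \<le> pdist L X} \<inter> {X \<in> S2R. pdist L X \<le> pdist K X})" by blast
  also have "{X \<in> S2R. pdist K X \<le> pdist L X} \<inter> {X \<in> S2R. pdist L X \<le> pdist K X} = ?A" by auto
  finally have A: "?A \<in> sets borel" by simp
  have eq: "(sdist (fst K) Q)\<^sup>2 + (t - snd K)\<^sup>2 = (sdist (fst L) Q)\<^sup>2 + (t - snd L)\<^sup>2" if "(Q, t) \<in> ?A" for Q t
    using that by (simp add: pdist_def)
  have "emeasure riem_vol ?A = 0"
  proof (cases "snd K = snd L")
    case False
    have "emeasure lborel {t. (Q, t) \<in> ?A} = 0" for Q
    proof -
      define a where "a = ((sdist (fst L) Q)\<^sup>2 - (sdist (fst K) Q)\<^sup>2 + (snd L)\<^sup>2 - (snd K)\<^sup>2) / (2 * (snd L - snd K))"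
      have "t = a" if "(Q, t) \<in> ?A" for t
      proof -
        have "t * (2 * (snd L - snd K)) = (sdist (fst L) Q)\<^sup>2 - (sdist (fst K) Q)\<^sup>2 + (snd L)\<^sup>2 - (snd K)\<^sup>2"
          using eq[OF that] by (simp add: power2_eq_square algebra_simps)
        then show ?thesis using False by (simp add: a_def eq_divide_eq)
      qed
      then have "{t. (Q, t) \<in> ?A} \<subseteq> {a}" by blast
      then have "emeasure lborel {t. (Q, t) \<in> ?A} \<le> emeasure lborel {a}" by (intro emeasure_mono) auto
      then show ?thesis by simp
    qed
    then show ?thesis by (simp only: emeasure_riem_vol_fibres[OF A]) simp
  next
    case True
    then have "fst K \<noteq> fst L" using ne by (auto intro: prod_eqI)
    define V where "V = (fst K - fst L) /\<^sub>R norm (fst K - fst L)"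
    have V: "norm V = 1" using \<open>fst K \<noteq> fst L\<close> by (simp add: V_def)
    have "emeasure sph_area {Q. (Q, t) \<in> ?A} = 0" for t
    proof -
      have "V \<bullet> Q = 0" if Q: "(Q, t) \<in> ?A" for Q
      proof -
        have n: "norm (fst K) = 1" "norm (fst L) = 1" "norm Q = 1" using Q K L by (auto simp: S2R_iff)
        have "(sdist (fst K) Q)\<^sup>2 = (sdist (fst L) Q)\<^sup>2" using eq[OF Q] True by simp
        then have "sdist (fst K) Q = sdist (fst L) Q"
          using sdist_bounds(1)[OF n(1,3)] sdist_bounds(1)[OF n(2,3)] by (simp add: power2_eq_iff_nonneg)
        then have "fst K \<bullet> Q = fst L \<bullet> Q" using sdist_bounds(3)[OF n(1,3)] sdist_bounds(3)[OF n(2,3)] by simp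
        then show ?thesis by (simp add: V_def inner_diff_left)
      qed
      then have "emeasure sph_area {Q. (Q, t) \<in> ?A} \<le> emeasure sph_area {Q. V \<bullet> Q = 0}"
        by (intro emeasure_mono) auto
      then show ?thesis using great_circle_null(1)[OF V] by simp
    qed
    then show ?thesis by (simp only: emeasure_riem_vol[OF A]) simp
  qed
  then show ?thesis using A by (intro null_setsI) auto
qed

lemma plane_y_null: "{X. fst X $ 2 = 0} \<in> null_sets riem_vol"
proof -
  have A: "{X :: pt. fst X $ 2 = 0} \<in> sets borel"
    by (intro borel_closed closed_Collect_eq continuous_intros)
  have "emeasure riem_vol {X. fst X $ 2 = 0} = 0"
    using great_circle_null(1)[of "axis 2 1"] by (simp add: emeasure_riem_vol[OF A] inner_axis')
  then show ?thesis using A by (intro null_setsI) auto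
qed

text \<open>Both inequalities are instances of \<open>tiling_emeasure_le\<close>. The images of the cell cover the space
  because each point has a nearest orbit point. They overlap in bisectors only, so they become
  disjoint once the null set \<open>N\<close> is removed; this set also contains the plane \<open>y = 0\<close>, which the images
  of the half slab miss.\<close>

lemma emeasure_dv_cell:
  assumes \<tau>: "0 < \<tau>" and K: "K \<in> S2R" and h: "motion \<tau> (False, 0) K \<noteq> K"
  shows "emeasure riem_vol (dv_cell (space_group \<tau>) K) = ennreal (2 * pi * \<tau>)"
proof (rule antisym)
  let ?D = "dv_cell (space_group \<tau>) K"
  have D: "?D \<in> sets borel" by (rule dv_cell_measurable[OF K])
  have mm: "motion \<tau> i \<in> riem_vol \<rightarrow>\<^sub>M riem_vol" for i by measurable
  have ne: "motion \<tau> i K \<noteq> K" if "i \<noteq> (True, 0)" for i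
    using motion_fixes_iff[OF \<tau> h] that by blast
  have "emeasure riem_vol (half_slab \<tau>) \<le> emeasure riem_vol ?D"
  proof (rule tiling_emeasure_le[where S = "motion \<tau>" and T = "\<lambda>i. motion \<tau> (motion_inv i)"])
    fix X assume "X \<in> half_slab \<tau>"
    then have X: "X \<in> S2R" by (simp add: half_slab_def)
    obtain i where i: "\<And>j. pdist (motion \<tau> i K) X \<le> pdist (motion \<tau> j K) X"
      using nearest_orbit_point[OF \<tau>] by blast
    have "pdist K (motion \<tau> (motion_inv i) X) \<le> pdist (motion \<tau> j K) (motion \<tau> (motion_inv i) X)" for j
    proof -
      have "pdist (motion \<tau> j K) (motion \<tau> (motion_inv i) X) = pdist (motion \<tau> i (motion \<tau> j K)) X"
        by (rule pdist_motion_inv)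
      then show ?thesis using i by (cases i, cases j) (simp add: pdist_motion_inv motion_motion)
    qed
    then have "motion \<tau> (motion_inv i) X \<in> ?D" unfolding dv_cell_eq[OF K] using X by simp
    then show "\<exists>i. motion \<tau> (motion_inv i) X \<in> ?D" by blast
  qed (use D half_slab_measurable \<tau> half_slab_unique emeasure_riem_vol_motion mm in auto)
  then show "ennreal (2 * pi * \<tau>) \<le> emeasure riem_vol ?D" by (simp add: emeasure_half_slab \<tau>)
  \<comment> \<open>for the converse inequality, keep only the points strictly nearest to \<open>K\<close>\<close>
  define N where "N = (\<Union>i\<in>-{(True, 0)}. {X \<in> S2R. pdist K X = pdist (motion \<tau> i K) X}) \<union> {X. fst X $ 2 = 0}"
  have N: "N \<in> null_sets riem_vol"
    unfolding N_def using bisector_null[OF K _ ne[symmetric]] K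
    by (intro null_sets.Un null_sets_UN' plane_y_null) auto
  have DN: "X \<in> S2R" "fst X $ 2 \<noteq> 0" "i \<noteq> (True, 0) \<Longrightarrow> pdist K X < pdist (motion \<tau> i K) X" if "X \<in> ?D - N" for X i
    using that K by (force simp: N_def dv_cell_eq less_le)+
  have "emeasure riem_vol (?D - N) \<le> emeasure riem_vol (half_slab \<tau>)"
  proof (rule tiling_emeasure_le[where S = "\<lambda>i. motion \<tau> (motion_inv i)" and T = "motion \<tau>"])
    fix i j X assume ij: "motion \<tau> (motion_inv i) X \<in> ?D - N" "motion \<tau> (motion_inv j) X \<in> ?D - N"
    have less: "pdist (motion \<tau> i K) X < pdist (motion \<tau> j K) X"
      if "motion \<tau> (motion_inv i) X \<in> ?D - N" "i \<noteq> j" for i j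
    proof -
      obtain b k c l where eq: "i = (b, k)" "j = (c, l)" by (cases i, cases j)
      define m where "m = (b = c, l - k)"
      have "m \<noteq> (True, 0)" using that(2) by (auto simp: m_def eq)
      then have "pdist K (motion \<tau> (motion_inv i) X) < pdist (motion \<tau> m K) (motion \<tau> (motion_inv i) X)"
        using DN(3)[OF that(1)] by blast
      then have "pdist (motion \<tau> i K) X < pdist (motion \<tau> i (motion \<tau> m K)) X" by (simp add: pdist_motion_inv)
      moreover have "motion \<tau> i (motion \<tau> m K) = motion \<tau> j K"
      proof -
        have "(b = (b = c)) = c" by auto
        then show ?thesis by (simp add: eq m_def motion_motion)
      qed
      ultimately show ?thesis by simp
    qed
    show "i = j" using less[OF ij(1), of j] less[OF ij(2), of i] by (cases "i = j") auto
  qed (use D N half_slab_measurable half_slab_cover[OF \<tau>] DN(1,2) emeasure_riem_vol_motion mm in auto)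
  then show "emeasure riem_vol ?D \<le> ennreal (2 * pi * \<tau>)"
    using emeasure_Diff_null_set[OF N, of ?D] D by (simp add: emeasure_half_slab \<tau>)
qed

section \<open>The densest packing\<close>

lemma pdist_motion_self:
  "pdist X (motion \<tau> i X) = sqrt ((arccos (turn_sign (fst i) * (fst X $ 1)\<^sup>2
      + turn_sign (fst i) * parity_sign (snd i) * (fst X $ 2)\<^sup>2 + (fst X $ 3)\<^sup>2))\<^sup>2 + (of_int (snd i) * \<tau>)\<^sup>2)"
  by (simp add: pdist_def sdist_def fst_motion snd_motion inner_vec_def sum_3 power2_eq_square algebra_simps)

lemma S2R_coordinates:
  "X \<in> S2R \<Longrightarrow> (fst X $ 1)\<^sup>2 + (fst X $ 2)\<^sup>2 + (fst X $ 3)\<^sup>2 = 1"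
  by (simp add: S2R_iff norm_eq_1 inner_vec_def sum_3 power2_eq_square)

text \<open>Each of the three upper bounds on \<open>r\<close> decides one range of \<open>t\<close>. In the middle range
  \<open>R / sqrt 3 \<le> t \<le> sqrt 3 * R\<close> the claim reduces to \<open>(sqrt 3 * t - R) * (t - sqrt 3 * R) \<le> 0\<close>.\<close>

lemma radius_period_inequality:
  fixes r t R :: real
  assumes "0 \<le> r" "0 < t" "0 < R" "r \<le> R" "r \<le> t" "4 * r\<^sup>2 \<le> R\<^sup>2 + t\<^sup>2"
  shows "sqrt 3 * r\<^sup>2 \<le> R * t"
proof -
  have s: "sqrt 3 * sqrt 3 = 3" "0 < sqrt 3" by simp_all
  consider "sqrt 3 * R \<le> t" | "sqrt 3 * t \<le> R" | "t \<le> sqrt 3 * R" "R \<le> sqrt 3 * t" by linarith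
  then show ?thesis
  proof cases
    case 1
    have "r\<^sup>2 \<le> R\<^sup>2" using assms by (intro power_mono)
    then have "sqrt 3 * r\<^sup>2 \<le> R * (sqrt 3 * R)"
      by (simp add: power2_eq_square)
    also have "\<dots> \<le> R * t" using 1 assms by (intro mult_left_mono) auto
    finally show ?thesis .
  next
    case 2
    have "r\<^sup>2 \<le> t\<^sup>2" using assms by (intro power_mono)
    then have "sqrt 3 * r\<^sup>2 \<le> (sqrt 3 * t) * t"
      by (simp add: power2_eq_square)
    also have "\<dots> \<le> R * t" using 2 assms by (intro mult_right_mono) auto
    finally show ?thesis .
  next
    case 3
    have "(sqrt 3 * t - R) * (t - sqrt 3 * R) \<le> 0"
      using 3 by (intro mult_nonneg_nonpos) auto
    moreover have "(sqrt 3 * t - R) * (t - sqrt 3 * R) = sqrt 3 * (R\<^sup>2 + t\<^sup>2) - R * t - sqrt 3 * sqrt 3 * (R * t)"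
      by (simp add: power2_eq_square algebra_simps)
    ultimately have "sqrt 3 * (R\<^sup>2 + t\<^sup>2) \<le> 4 * (R * t)" unfolding s(1) by linarith
    moreover have "sqrt 3 * (4 * r\<^sup>2) \<le> sqrt 3 * (R\<^sup>2 + t\<^sup>2)" using assms by (intro mult_left_mono) auto
    moreover have "sqrt 3 * (4 * r\<^sup>2) = 4 * (sqrt 3 * r\<^sup>2)" by simp
    ultimately show ?thesis by linarith
  qed
qed

lemma packing_density_eq:
  assumes "0 < \<tau>" "K \<in> S2R" "motion \<tau> (False, 0) K \<noteq> K"
  shows "packing_density (space_group \<tau>) K =
    measure riem_vol (gball K (packing_radius (space_group \<tau>) K)) / (2 * pi * \<tau>)"
  using emeasure_dv_cell[OF assms] assms(1)
  by (simp add: packing_density_def packing_ball_def measure_def[of _ "dv_cell _ _"])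

text \<open>The bounds come from the half turn, from the translation by \<open>2 * \<tau>\<close>, and from one of the two
  reflections. The reflection in \<open>y = 0\<close> moves the point by an angle with cosine \<open>x\<^sup>2 - y\<^sup>2 + z\<^sup>2\<close>, the
  one in \<open>x = 0\<close> by an angle with cosine \<open>y\<^sup>2 - x\<^sup>2 + z\<^sup>2\<close>, and at least one of these cosines is
  nonnegative.\<close>

lemma packing_radius_bounds:
  assumes \<tau>: "0 < \<tau>" and K: "K \<in> S2R" and h: "motion \<tau> (False, 0) K \<noteq> K"
  defines "r \<equiv> packing_radius (space_group \<tau>) K"
  shows "0 \<le> r" "r \<le> pi/2" "r \<le> \<tau>" "4 * r\<^sup>2 \<le> (pi/2)\<^sup>2 + \<tau>\<^sup>2"
proof -
  have r0: "0 \<le> r" and le: "2 * r \<le> pdist K (motion \<tau> i K)" if "i \<noteq> (True, 0)" for i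
    using packing_radius_greatest(1)[OF K, of \<tau>] motion_fixes_iff[OF \<tau> h, of i] that
    unfolding r_def by auto
  show r0: "0 \<le> r" using packing_radius_greatest(1)[OF K, of \<tau>] unfolding r_def by auto
  define x y z where "x = (fst K $ 1)\<^sup>2" and "y = (fst K $ 2)\<^sup>2" and "z = (fst K $ 3)\<^sup>2"
  have xyz: "x + y + z = 1" "0 \<le> x" "0 \<le> y" "0 \<le> z"
    using S2R_coordinates[OF K] by (auto simp: x_def y_def z_def)
  note d = pdist_motion_self[of K \<tau>, folded x_def y_def z_def]
  have "arccos (- x - y + z) \<le> pi" "0 \<le> arccos (- x - y + z)"
    using xyz by (auto intro!: arccos_ubound arccos_lbound)
  then show "r \<le> pi/2" using le[of "(False, 0)"] d[of "(False, 0)"] by simp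
  show "r \<le> \<tau>" using le[of "(True, 2)"] d[of "(True, 2)"] xyz \<tau> by (simp add: real_sqrt_mult)
  have near: "4 * r\<^sup>2 \<le> (pi/2)\<^sup>2 + \<tau>\<^sup>2" if "2 * r \<le> sqrt ((arccos c)\<^sup>2 + \<tau>\<^sup>2)" "0 \<le> c" "c \<le> 1" for c
  proof -
    have "(2 * r)\<^sup>2 \<le> (sqrt ((arccos c)\<^sup>2 + \<tau>\<^sup>2))\<^sup>2" using that r0 by (intro power_mono) auto
    then have "4 * r\<^sup>2 \<le> (arccos c)\<^sup>2 + \<tau>\<^sup>2" by (simp add: power_mult_distrib)
    moreover have "(arccos c)\<^sup>2 \<le> (pi/2)\<^sup>2"
      using that arccos_le_pi2[of c] by (intro power_mono) (auto intro: arccos_lbound)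
    ultimately show ?thesis by linarith
  qed
  show "4 * r\<^sup>2 \<le> (pi/2)\<^sup>2 + \<tau>\<^sup>2"
  proof (cases "y \<le> x")
    case True
    then show ?thesis using le[of "(True, 1)"] d[of "(True, 1)"] xyz by (intro near[of "x - y + z"]) auto
  next
    case False
    then show ?thesis using le[of "(False, 1)"] d[of "(False, 1)"] xyz by (intro near[of "y - x + z"]) auto
  qed
qed

theorem theorem3p7:
  fixes R :: real and K :: pt
  assumes "R = pi / 2" and "K = (geo (pi / 4) 0, 0)"
  shows "\<exists>\<tau>>0.
    (\<forall>\<sigma>>0. (gdist K (lift_isom refl1 \<sigma> K) = 2 * R \<and>
             gdist K (lift_isom refl2 \<sigma> K) = 2 * R \<and>
             gdist (lift_isom refl1 \<sigma> K) (lift_isom refl2 \<sigma> K) = 2 * R) \<longleftrightarrow> \<sigma> = \<tau>) \<and>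
    trivial_stabilizer (space_group \<tau>) K \<and>
    packing_radius (space_group \<tau>) K = R \<and>
    (\<forall>\<tau>'>0. \<forall>K'\<in>S2R. trivial_stabilizer (space_group \<tau>') K' \<longrightarrow>
       packing_density (space_group \<tau>') K' \<le> packing_density (space_group \<tau>) K)"
proof -
  define \<tau> where "\<tau> = sqrt 3 * R"
  have R: "0 < R" "R \<le> pi/2" "2 * R = pi" and \<tau>: "0 < \<tau>" unfolding \<tau>_def assms(1) by simp_all
  have K: "K \<in> S2R" by (simp add: assms(2) S2R_iff)
  have K_coord: "(fst K $ 1)\<^sup>2 = 1/2" "(fst K $ 2)\<^sup>2 = 1/2" "fst K $ 3 = 0"
    by (simp_all add: assms(2) cos_45 sin_45 power_divide)
  have dK: "pdist K (motion \<sigma> i K) =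
      sqrt ((arccos ((turn_sign (fst i) + turn_sign (fst i) * parity_sign (snd i)) / 2))\<^sup>2 + (of_int (snd i) * \<sigma>)\<^sup>2)" for \<sigma> i
    by (simp add: pdist_motion_self K_coord add_divide_distrib)
  have half: "pdist K (motion \<sigma> (False, 0) K) = pi" for \<sigma> by (simp add: dK)
  have h: "motion \<sigma> (False, 0) K \<noteq> K" for \<sigma>
  proof
    assume "motion \<sigma> (False, 0) K = K"
    then have "pdist K K = pi" using half[of \<sigma>] by (simp only:)
    moreover have "pdist K K = 0" using dK[of \<sigma> "(True, 0)"] by simp
    ultimately show False by simp
  qed
  have cond: "(gdist K (lift_isom refl1 \<sigma> K) = 2 * R \<and> gdist K (lift_isom refl2 \<sigma> K) = 2 * R \<and>
      gdist (lift_isom refl1 \<sigma> K) (lift_isom refl2 \<sigma> K) = 2 * R) \<longleftrightarrow> \<sigma> = \<tau>" if \<sigma>: "0 < \<sigma>" for \<sigma>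
  proof -
    have e: "2 * R = sqrt ((2 * R)\<^sup>2)" using R(1) by (subst real_sqrt_abs) simp
    have "motion \<sigma> (False, 1) K = motion \<sigma> (True, 1) (motion \<sigma> (False, 0) K)" by (simp add: motion_motion)
    then have "pdist (motion \<sigma> (True, 1) K) (motion \<sigma> (False, 1) K) = pi" by (simp only: pdist_motion half)
    then have "(gdist K (lift_isom refl1 \<sigma> K) = 2 * R \<and> gdist K (lift_isom refl2 \<sigma> K) = 2 * R \<and>
      gdist (lift_isom refl1 \<sigma> K) (lift_isom refl2 \<sigma> K) = 2 * R) \<longleftrightarrow> sqrt (R\<^sup>2 + \<sigma>\<^sup>2) = 2 * R"
      using K by (simp add: lift_isom_smotion gdist_eq dK assms(1))
    also have "\<dots> \<longleftrightarrow> R\<^sup>2 + \<sigma>\<^sup>2 = (2 * R)\<^sup>2"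
      by (metis e real_sqrt_eq_iff)
    also have "\<dots> \<longleftrightarrow> \<sigma>\<^sup>2 = \<tau>\<^sup>2" by (auto simp: \<tau>_def power_mult_distrib)
    also have "\<dots> \<longleftrightarrow> \<sigma> = \<tau>" using \<sigma> \<tau> by (simp add: power2_eq_iff_nonneg)
    finally show ?thesis .
  qed
  have radius: "packing_radius (space_group \<tau>) K = R"
  proof (rule antisym)
    show "packing_radius (space_group \<tau>) K \<le> R"
      using packing_radius_bounds(2)[OF \<tau> K h] assms(1) by simp
    have "2 * R \<le> pdist K (motion \<tau> i K)" if "i \<noteq> (True, 0)" for i
    proof -
      obtain b k where i: "i = (b, k)" by (cases i)
      have sq: "1 \<le> (of_int j :: real)\<^sup>2" if "j \<noteq> 0" for j :: int
      proof -
        have "1 \<le> \<bar>of_int j :: real\<bar>" using that by linarith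
        then have "1\<^sup>2 \<le> \<bar>of_int j :: real\<bar>\<^sup>2" by (intro power_mono) auto
        then show ?thesis by simp
      qed
      have "(2 * R)\<^sup>2 \<le> (arccos ((turn_sign b + turn_sign b * parity_sign k) / 2))\<^sup>2 + (of_int k * \<tau>)\<^sup>2"
      proof (cases "even k")
        case True
        show ?thesis
        proof (cases b)
          case True
          \<comment> \<open>a pure translation leaves the angle zero, but then \<open>k\<close> is at least \<open>2\<close> in absolute value\<close>
          then have "k \<noteq> 0" using that i by auto
          obtain m where m: "k = 2 * m" using \<open>even k\<close> by (elim evenE)
          have "1 * R\<^sup>2 \<le> (of_int m)\<^sup>2 * R\<^sup>2"
            using \<open>k \<noteq> 0\<close> m by (intro mult_right_mono sq) auto
          then have "4 * R\<^sup>2 \<le> 12 * ((of_int m)\<^sup>2 * R\<^sup>2)" using zero_le_power2[of R] by linarith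
          also have "\<dots> = (of_int k * \<tau>)\<^sup>2" by (simp add: m \<tau>_def power_mult_distrib)
          finally show ?thesis by (simp add: power_mult_distrib add_increasing)
        next
          case False
          then show ?thesis using \<open>even k\<close> R by (simp add: parity_sign_def)
        qed
      next
        case False
        then have "3 * R\<^sup>2 \<le> (of_int k * \<tau>)\<^sup>2"
          using sq[of k] mult_right_mono[of 1 "(of_int k)\<^sup>2" "3 * R\<^sup>2"] by (cases "k = 0") (auto simp: \<tau>_def power_mult_distrib)
        moreover have "arccos ((turn_sign b + turn_sign b * parity_sign k) / 2) = R" using False assms(1) by (simp add: parity_sign_def)
        ultimately show ?thesis by (simp add: power_mult_distrib)
      qed
      then show ?thesis using R by (simp add: dK i real_le_rsqrt)
    qed
    then show "R \<le> packing_radius (space_group \<tau>) K"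
      using R motion_fixes_iff[OF \<tau> h] by (intro packing_radius_greatest(2)[OF K]) auto
  qed
  have dens: "packing_density (space_group \<tau>') K' \<le> packing_density (space_group \<tau>) K"
    if \<tau>': "0 < \<tau>'" and K': "K' \<in> S2R" and st: "trivial_stabilizer (space_group \<tau>') K'" for \<tau>' K'
  proof -
    define r where "r = packing_radius (space_group \<tau>') K'"
    define V where "V = measure riem_vol (gball K R)"
    have h': "motion \<tau>' (False, 0) K' \<noteq> K'" by (rule trivial_stabilizer_half_turn[OF st K'])
    have r: "0 \<le> r" "r \<le> R" "r \<le> \<tau>'" "4 * r\<^sup>2 \<le> R\<^sup>2 + \<tau>'\<^sup>2"
      using packing_radius_bounds[OF \<tau>' K' h'] by (auto simp: r_def assms(1))
    have V: "0 \<le> V" by (simp add: V_def)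
    have "packing_density (space_group \<tau>') K' = measure riem_vol (gball K' r) / (2 * pi * \<tau>')"
      by (simp add: packing_density_eq \<tau>' K' h' r_def)
    also have "\<dots> \<le> ((r / R)\<^sup>2 * V) / (2 * pi * \<tau>')"
      unfolding V_def using \<tau>' r R K K' by (intro divide_right_mono measure_gball_scale) auto
    also have "\<dots> \<le> V / (2 * pi * \<tau>)"
    proof -
      have "sqrt 3 * r\<^sup>2 \<le> R * \<tau>'" using radius_period_inequality r \<tau>' R(1) by blast
      then have "(r / R)\<^sup>2 * \<tau> \<le> \<tau>'"
        using R by (simp add: \<tau>_def power_divide power2_eq_square field_simps)
      then have le: "(r / R)\<^sup>2 * \<tau> * V \<le> \<tau>' * V" using V by (rule mult_right_mono)
      have "q * V / (2 * pi * \<tau>') \<le> V / (2 * pi * \<tau>)" if "q * \<tau> * V \<le> \<tau>' * V" for q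
        using that \<tau> \<tau>' by (simp add: field_simps)
      from this[OF le] show ?thesis .
    qed
    also have "\<dots> = packing_density (space_group \<tau>) K"
      by (simp add: packing_density_eq \<tau> K h radius V_def)
    finally show ?thesis .
  qed
  show ?thesis
    using \<tau> cond trivial_stabilizer_if_half_turn_moves[OF \<tau> K h] radius dens by blast
qed

end
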